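(* Let $A$ be a (Noetherian) local Cohen--Macaulay ring. Then $A$ is a normal domain if and only if the localization $A_p$ is a normal domain for all prime ideals $p$ of $A$ of height at most $1$.
   Context: Rings are commutative with identity. A normal domain is an integral domain that is integrally closed in its field of fractions. *)

theory Defs
  imports "HOL-Algebra.Algebra" "HOL-Library.Extended_Nat"
begin

section \<open>Localization\<close>

text \<open>Fractions are classes of pairs (numerator, denominator). The factor \<open>u\<close> is needed because
  \<open>S\<close> may contain zero divisors.\<close>

definition frac_rel :: "('a, 'b) ring_scheme \<Rightarrow> 'a set \<Rightarrow> (('a \<times> 'a) \<times> ('a \<times> 'a)) set" where
  "frac_rel R S =
    {((a, s), (b, t)). a \<in> carrier R \<and> s \<in> S \<and> b \<in> carrier R \<and> t \<in> S \<and>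
      (\<exists>u\<in>S. u \<otimes>\<^bsub>R\<^esub> (t \<otimes>\<^bsub>R\<^esub> a \<ominus>\<^bsub>R\<^esub> s \<otimes>\<^bsub>R\<^esub> b) = \<zero>\<^bsub>R\<^esub>)}"

definition fraction :: "('a, 'b) ring_scheme \<Rightarrow> 'a set \<Rightarrow> 'a \<Rightarrow> 'a \<Rightarrow> ('a \<times> 'a) set" where
  "fraction R S a s = frac_rel R S `` {(a, s)}"

text \<open>Meaningful when \<open>S\<close> is a multiplicatively closed subset of the commutative ring \<open>R\<close> that
  contains \<open>\<one>\<close>; the inner sets of the unions below are then all equal, as for
  \<^const>\<open>rcoset_mult\<close>.\<close>

definition localization :: "('a, 'b) ring_scheme \<Rightarrow> 'a set \<Rightarrow> ('a \<times> 'a) set ring" where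
  "localization R S =
    \<lparr>carrier = (carrier R \<times> S) // frac_rel R S,
     monoid.mult = (\<lambda>P Q. \<Union>(a, s)\<in>P. \<Union>(b, t)\<in>Q. fraction R S (a \<otimes>\<^bsub>R\<^esub> b) (s \<otimes>\<^bsub>R\<^esub> t)),
     one = fraction R S \<one>\<^bsub>R\<^esub> \<one>\<^bsub>R\<^esub>,
     ring.zero = fraction R S \<zero>\<^bsub>R\<^esub> \<one>\<^bsub>R\<^esub>,
     ring.add = (\<lambda>P Q. \<Union>(a, s)\<in>P. \<Union>(b, t)\<in>Q.
              fraction R S (a \<otimes>\<^bsub>R\<^esub> t \<oplus>\<^bsub>R\<^esub> b \<otimes>\<^bsub>R\<^esub> s) (s \<otimes>\<^bsub>R\<^esub> t))\<rparr>"

definition localization_at :: "('a, 'b) ring_scheme \<Rightarrow> 'a set \<Rightarrow> ('a \<times> 'a) set ring" where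
  "localization_at R p = localization R (carrier R - p)"

definition fraction_field :: "('a, 'b) ring_scheme \<Rightarrow> ('a \<times> 'a) set ring" where
  "fraction_field R = localization R (carrier R - {\<zero>\<^bsub>R\<^esub>})"


section \<open>Normal domains\<close>

text \<open>Polynomials are lists of coefficients starting with the leading one; \<open>[]\<close> is the zero
  polynomial.\<close>

definition integral_over :: "('a, 'b) ring_scheme \<Rightarrow> 'a set \<Rightarrow> 'a \<Rightarrow> bool" where
  "integral_over L K x \<longleftrightarrow>
    (\<exists>f. polynomial\<^bsub>L\<^esub> K f \<and> f \<noteq> [] \<and> lead_coeff f = \<one>\<^bsub>L\<^esub> \<and> ring.eval L f x = \<zero>\<^bsub>L\<^esub>)"

locale normal_domain = domain R for R (structure) +
  assumes integrally_closed:
    "\<lbrakk>x \<in> carrier (fraction_field R);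
      integral_over (fraction_field R) ((\<lambda>a. fraction R (carrier R - {\<zero>}) a \<one>) ` carrier R) x\<rbrakk>
     \<Longrightarrow> x \<in> (\<lambda>a. fraction R (carrier R - {\<zero>}) a \<one>) ` carrier R"


section \<open>Height and Krull dimension\<close>

definition prime_chain :: "('a, 'b) ring_scheme \<Rightarrow> nat \<Rightarrow> (nat \<Rightarrow> 'a set) \<Rightarrow> bool" where
  "prime_chain R n C \<longleftrightarrow> (\<forall>i\<le>n. primeideal (C i) R) \<and> (\<forall>i<n. C i \<subset> C (Suc i))"

definition height :: "('a, 'b) ring_scheme \<Rightarrow> 'a set \<Rightarrow> enat" where
  "height R p = Sup {enat n | n. \<exists>C. prime_chain R n C \<and> C n = p}"

definition krull_dim :: "('a, 'b) ring_scheme \<Rightarrow> enat" where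
  "krull_dim R = Sup {enat n | n. \<exists>C. prime_chain R n C}"


section \<open>Cohen--Macaulay local rings\<close>

definition nonzerodivisor :: "('a, 'b) ring_scheme \<Rightarrow> 'a \<Rightarrow> bool" where
  "nonzerodivisor R x \<longleftrightarrow>
    x \<in> carrier R \<and> (\<forall>y\<in>carrier R. x \<otimes>\<^bsub>R\<^esub> y = \<zero>\<^bsub>R\<^esub> \<longrightarrow> y = \<zero>\<^bsub>R\<^esub>)"

definition regular_sequence :: "('a, 'b) ring_scheme \<Rightarrow> 'a list \<Rightarrow> bool" where
  "regular_sequence R xs \<longleftrightarrow>
    set xs \<subseteq> carrier R \<and>
    (\<forall>i<length xs. nonzerodivisor (R Quot Idl\<^bsub>R\<^esub> (set (take i xs)))
                                  (Idl\<^bsub>R\<^esub> (set (take i xs)) +>\<^bsub>R\<^esub> (xs ! i))) \<and>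
    Idl\<^bsub>R\<^esub> (set xs) \<noteq> carrier R"

text \<open>The depth of \<open>R\<close> with respect to an ideal \<open>I\<close>; the depth of a local ring is the case where
  \<open>I\<close> is the maximal ideal.\<close>

definition depth :: "('a, 'b) ring_scheme \<Rightarrow> 'a set \<Rightarrow> enat" where
  "depth R I = Sup {enat (length xs) | xs. regular_sequence R xs \<and> set xs \<subseteq> I}"

locale local_ring = cring R for R (structure) +
  assumes unique_maximal: "\<exists>!m. maximalideal m R"

locale cohen_macaulay_local_ring = local_ring R + noetherian_ring R for R (structure) +
  assumes depth_eq_dim: "maximalideal m R \<Longrightarrow> depth R m = krull_dim R"

end

theory Submission
  imports Defs
begin

text \<open>The substance is the converse, Serre's criterion. An associated prime of an ideal \<open>J\<close> with
  \<open>depth (A / J) \<ge> n\<close> starts a prime chain of length \<open>n\<close>. If \<open>A\<close> is Cohen--Macaulay of dimension \<open>d\<close>,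
  then \<open>n = d\<close> is possible for \<open>J = 0\<close>, and \<open>n = d - 1\<close> for \<open>J = (x)\<close> with \<open>x\<close> regular, since every
  regular element starts a regular sequence of maximal length; so the associated primes of these
  ideals have height at most 1. The same exchange of regular elements shows by the ascending chain
  condition that the depth, and with it \<open>d\<close>, is finite.

  An element that lies in \<open>(x)\<close> locally at the associated primes of \<open>(x)\<close> lies in \<open>(x)\<close>. So if
  \<open>a / b\<close> is integral, normality of these localizations gives \<open>a \<in> (b)\<close>. That \<open>A\<close> is a domain
  follows in the same way: \<open>A\<close> is reduced, and if it has zero divisors, then there are \<open>i\<close>, \<open>k\<close> with
  \<open>i k = 0\<close> and \<open>i + k\<close> regular; then \<open>i / (i + k)\<close> lies in \<open>A\<close> and is an idempotent, which is \<open>0\<close>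
  or \<open>1\<close> because \<open>A\<close> is local.\<close>

text \<open>As a simp set these rules prove identities with subtraction in commutative rings:
  products are expanded, subtractions move outwards and then across the equation, and the remaining
  sums are sorted.\<close>

lemma (in cring) diff_simps:
  assumes "a \<in> carrier R" "b \<in> carrier R" "c \<in> carrier R"
  shows "(a \<ominus> b) \<oplus> c = (a \<oplus> c) \<ominus> b" "c \<oplus> (a \<ominus> b) = (c \<oplus> a) \<ominus> b"
    "(a \<ominus> b) \<ominus> c = a \<ominus> (b \<oplus> c)" "a \<ominus> (b \<ominus> c) = (a \<oplus> c) \<ominus> b"
    "a \<otimes> (b \<ominus> c) = a \<otimes> b \<ominus> a \<otimes> c" "(b \<ominus> c) \<otimes> a = b \<otimes> a \<ominus> c \<otimes> a"
    "a \<ominus> b = c \<longleftrightarrow> a = c \<oplus> b" "c = a \<ominus> b \<longleftrightarrow> c \<oplus> b = a"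
    "a \<oplus> b = b \<oplus> a" "(a \<oplus> b) \<oplus> c = a \<oplus> (b \<oplus> c)" "a \<oplus> (b \<oplus> c) = b \<oplus> (a \<oplus> c)"
    "a \<otimes> b = b \<otimes> a" "(a \<otimes> b) \<otimes> c = a \<otimes> (b \<otimes> c)" "a \<otimes> (b \<otimes> c) = b \<otimes> (a \<otimes> c)"
    "(a \<oplus> b) \<otimes> c = a \<otimes> c \<oplus> b \<otimes> c" "c \<otimes> (a \<oplus> b) = c \<otimes> a \<oplus> c \<otimes> b"
proof -
  show 7: "a \<ominus> b = c \<longleftrightarrow> a = c \<oplus> b"
    using assms by (auto simp: minus_eq a_assoc l_neg r_neg)
  then show "c = a \<ominus> b \<longleftrightarrow> c \<oplus> b = a" by metis
qed (use assms in \<open>simp_all add: minus_eq l_distr r_distr l_minus r_minus minus_add a_ac m_ac\<close>)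

section \<open>Localization\<close>

locale multiplicative_subset = cring R for R (structure) +
  fixes S :: "'a set"
  assumes S_subset: "S \<subseteq> carrier R"
    and one_S: "\<one> \<in> S"
    and mult_S: "\<lbrakk>s \<in> S; t \<in> S\<rbrakk> \<Longrightarrow> s \<otimes> t \<in> S"
begin

abbreviation frac :: "'a \<Rightarrow> 'a \<Rightarrow> ('a \<times> 'a) set" where
  "frac \<equiv> fraction R S"

abbreviation Loc :: "('a \<times> 'a) set ring" where
  "Loc \<equiv> localization R S"

lemma S_carr: "s \<in> S \<Longrightarrow> s \<in> carrier R"
  using S_subset by auto

lemma equiv_frac_rel: "equiv (carrier R \<times> S) (frac_rel R S)"
proof (rule equivI)
  show "frac_rel R S \<subseteq> (carrier R \<times> S) \<times> (carrier R \<times> S)"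
    by (auto simp: frac_rel_def)
  show "refl_on (carrier R \<times> S) (frac_rel R S)"
  proof (rule refl_onI)
    fix x assume "x \<in> carrier R \<times> S"
    then obtain a s where x: "x = (a, s)" "a \<in> carrier R" "s \<in> S" by auto
    then have "\<one> \<otimes> (s \<otimes> a \<ominus> s \<otimes> a) = \<zero>" using S_carr by simp
    then show "(x, x) \<in> frac_rel R S" using x one_S by (auto simp: frac_rel_def)
  qed
  show "sym (frac_rel R S)"
  proof (rule symI)
    fix x y assume "(x, y) \<in> frac_rel R S"
    then obtain a s b t u where *: "x = (a, s)" "y = (b, t)" "a \<in> carrier R" "s \<in> S"
      "b \<in> carrier R" "t \<in> S" "u \<in> S" "u \<otimes> (t \<otimes> a \<ominus> s \<otimes> b) = \<zero>"
      by (auto simp: frac_rel_def)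
    note c = *(3,5) *(4,6,7)[THEN S_carr]
    have "u \<otimes> (s \<otimes> b \<ominus> t \<otimes> a) = \<zero>"
      using *(8) c by (simp add: diff_simps)
    then show "(y, x) \<in> frac_rel R S" using * by (auto simp: frac_rel_def)
  qed
  show "trans (frac_rel R S)"
  proof (rule transI)
    fix x y z assume "(x, y) \<in> frac_rel R S" "(y, z) \<in> frac_rel R S"
    then obtain a s b t c r u v where *: "x = (a, s)" "y = (b, t)" "z = (c, r)" "a \<in> carrier R"
      "b \<in> carrier R" "c \<in> carrier R" "s \<in> S" "t \<in> S" "r \<in> S" "u \<in> S" "v \<in> S"
      and u: "u \<otimes> (t \<otimes> a \<ominus> s \<otimes> b) = \<zero>" and v: "v \<otimes> (r \<otimes> b \<ominus> t \<otimes> c) = \<zero>"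
      by (auto simp: frac_rel_def)
    note c = *(4-6) *(7-11)[THEN S_carr]
    \<comment> \<open>Multiplying the two relations by \<open>v r\<close> and \<open>u s\<close>
      makes the terms in \<open>b\<close> cancel. What is left carries the extra factor
      \<open>t\<close>, so the new witness is \<open>u v t\<close>.\<close>
    have "u \<otimes> v \<otimes> t \<otimes> (r \<otimes> a \<ominus> s \<otimes> c) =
        v \<otimes> r \<otimes> (u \<otimes> (t \<otimes> a \<ominus> s \<otimes> b)) \<oplus> u \<otimes> s \<otimes> (v \<otimes> (r \<otimes> b \<ominus> t \<otimes> c))"
      using c by (simp add: diff_simps)
    also have "\<dots> = \<zero>" using c by (simp add: u v)
    finally show "(x, z) \<in> frac_rel R S"
      using * mult_S by (auto simp: frac_rel_def)
  qed
qed

lemma frac_eq_iff: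
  assumes "a \<in> carrier R" "s \<in> S" "b \<in> carrier R" "t \<in> S"
  shows "frac a s = frac b t \<longleftrightarrow> (\<exists>u\<in>S. u \<otimes> (t \<otimes> a) = u \<otimes> (s \<otimes> b))"
proof -
  have "frac a s = frac b t \<longleftrightarrow> ((a, s), (b, t)) \<in> frac_rel R S"
    unfolding fraction_def using assms by (intro eq_equiv_class_iff[OF equiv_frac_rel]) auto
  also have "\<dots> \<longleftrightarrow> (\<exists>u\<in>S. u \<otimes> (t \<otimes> a \<ominus> s \<otimes> b) = \<zero>)"
    using assms by (auto simp: frac_rel_def)
  also have "\<dots> \<longleftrightarrow> (\<exists>u\<in>S. u \<otimes> (t \<otimes> a) = u \<otimes> (s \<otimes> b))"
  proof (rule bex_cong[OF refl])
    fix u assume "u \<in> S"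
    then have c: "u \<in> carrier R" "t \<in> carrier R" "s \<in> carrier R" "a \<in> carrier R" "b \<in> carrier R"
      using assms S_carr by auto
    have "u \<otimes> (t \<otimes> a \<ominus> s \<otimes> b) = u \<otimes> (t \<otimes> a) \<ominus> u \<otimes> (s \<otimes> b)"
      using c by (simp add: diff_simps)
    then show "u \<otimes> (t \<otimes> a \<ominus> s \<otimes> b) = \<zero> \<longleftrightarrow> u \<otimes> (t \<otimes> a) = u \<otimes> (s \<otimes> b)"
      using c assms by simp
  qed
  finally show ?thesis .
qed

lemma frac_eqI:
  assumes "a \<in> carrier R" "s \<in> S" "b \<in> carrier R" "t \<in> S" "t \<otimes> a = s \<otimes> b"
  shows "frac a s = frac b t"
  using assms one_S by (subst frac_eq_iff) auto

lemma frac_in_carrier: "\<lbrakk>a \<in> carrier R; s \<in> S\<rbrakk> \<Longrightarrow> frac a s \<in> carrier Loc"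
  by (auto simp: localization_def fraction_def intro: quotientI)

lemma frac_cases:
  assumes "x \<in> carrier Loc"
  obtains a s where "a \<in> carrier R" "s \<in> S" "x = frac a s"
  using assms by (auto simp: localization_def fraction_def elim: quotientE)

lemma frac_self: "\<lbrakk>a \<in> carrier R; s \<in> S\<rbrakk> \<Longrightarrow> (a, s) \<in> frac a s"
  unfolding fraction_def by (rule equiv_class_self[OF equiv_frac_rel]) auto

lemma mem_fracD:
  assumes "x \<in> frac a s" "a \<in> carrier R" "s \<in> S"
  obtains b t u where "x = (b, t)" "b \<in> carrier R" "t \<in> S" "u \<in> S"
    "u \<otimes> (t \<otimes> a) = u \<otimes> (s \<otimes> b)"
proof -
  obtain b t where x: "x = (b, t)" by force
  then have r: "((a, s), (b, t)) \<in> frac_rel R S" using assms by (auto simp: fraction_def)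
  then have c: "b \<in> carrier R" "t \<in> S" by (auto simp: frac_rel_def)
  have "frac a s = frac b t" unfolding fraction_def using equiv_class_eq[OF equiv_frac_rel r] .
  then show ?thesis using frac_eq_iff[of a s b t] x c assms that by auto
qed

text \<open>Operations on classes are unions over all representatives. When the inner sets agree,
  the union over a nonempty family collapses to one of them; this reduces \<open>mult_frac\<close>
  and \<open>add_frac\<close> to independence of the representatives.\<close>

lemma frac_op:
  assumes "a \<in> carrier R" "s \<in> S" "b \<in> carrier R" "t \<in> S"
    and wd: "\<And>a' s' b' t'. \<lbrakk>(a', s') \<in> frac a s; (b', t') \<in> frac b t\<rbrakk> \<Longrightarrow> F a' s' b' t' = F a s b t"
  shows "(\<Union>(a', s')\<in>frac a s. \<Union>(b', t')\<in>frac b t. F a' s' b' t') = F a s b t"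
proof -
  have *: "(\<Union>y\<in>Y. f y) = c" if "x \<in> Y" "\<And>y. y \<in> Y \<Longrightarrow> f y = c"
    for x Y and c :: "'c set" and f
    using that by blast
  have "(\<Union>(b', t')\<in>frac b t. F a' s' b' t') = F a s b t" if "(a', s') \<in> frac a s" for a' s'
    using frac_self[OF assms(3,4)] by (rule *) (auto dest: wd[OF that])
  then show ?thesis
    by (intro *[OF frac_self[OF assms(1,2)]]) auto
qed

lemma mult_frac:
  assumes "a \<in> carrier R" "s \<in> S" "b \<in> carrier R" "t \<in> S"
  shows "frac a s \<otimes>\<^bsub>Loc\<^esub> frac b t = frac (a \<otimes> b) (s \<otimes> t)"
proof -
  have "(\<Union>(a', s')\<in>frac a s. \<Union>(b', t')\<in>frac b t. frac (a' \<otimes> b') (s' \<otimes> t'))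
      = frac (a \<otimes> b) (s \<otimes> t)"
  proof (rule frac_op[OF assms])
    fix a' s' b' t' assume a': "(a', s') \<in> frac a s" and b': "(b', t') \<in> frac b t"
    obtain u where 1: "a' \<in> carrier R" "s' \<in> S" "u \<in> S"
      and u: "u \<otimes> (s' \<otimes> a) = u \<otimes> (s \<otimes> a')"
      using mem_fracD[OF a' assms(1,2)] by auto
    obtain v where 2: "b' \<in> carrier R" "t' \<in> S" "v \<in> S"
      and v: "v \<otimes> (t' \<otimes> b) = v \<otimes> (t \<otimes> b')"
      using mem_fracD[OF b' assms(3,4)] by auto
    note c = 1(1) 2(1) 1(2,3)[THEN S_carr] 2(2,3)[THEN S_carr] assms(1,3) assms(2,4)[THEN S_carr]
    have "u \<otimes> v \<otimes> (s' \<otimes> t' \<otimes> (a \<otimes> b)) = (u \<otimes> (s' \<otimes> a)) \<otimes> (v \<otimes> (t' \<otimes> b))"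
      using c by (simp add: diff_simps)
    also have "\<dots> = u \<otimes> v \<otimes> (s \<otimes> t \<otimes> (a' \<otimes> b'))"
      unfolding u v using c by (simp add: diff_simps)
    finally have "u \<otimes> v \<otimes> (s' \<otimes> t' \<otimes> (a \<otimes> b)) = u \<otimes> v \<otimes> (s \<otimes> t \<otimes> (a' \<otimes> b'))" .
    then show "frac (a' \<otimes> b') (s' \<otimes> t') = frac (a \<otimes> b) (s \<otimes> t)"
      using 1 2 c mult_S assms by (subst frac_eq_iff) (auto intro!: bexI[of _ "u \<otimes> v"])
  qed
  then show ?thesis by (simp add: localization_def)
qed

lemma add_frac:
  assumes "a \<in> carrier R" "s \<in> S" "b \<in> carrier R" "t \<in> S"
  shows "frac a s \<oplus>\<^bsub>Loc\<^esub> frac b t = frac (a \<otimes> t \<oplus> b \<otimes> s) (s \<otimes> t)"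
proof -
  have "(\<Union>(a', s')\<in>frac a s. \<Union>(b', t')\<in>frac b t. frac (a' \<otimes> t' \<oplus> b' \<otimes> s') (s' \<otimes> t'))
      = frac (a \<otimes> t \<oplus> b \<otimes> s) (s \<otimes> t)"
  proof (rule frac_op[OF assms])
    fix a' s' b' t' assume a': "(a', s') \<in> frac a s" and b': "(b', t') \<in> frac b t"
    obtain u where 1: "a' \<in> carrier R" "s' \<in> S" "u \<in> S"
      and u: "u \<otimes> (s' \<otimes> a) = u \<otimes> (s \<otimes> a')"
      using mem_fracD[OF a' assms(1,2)] by auto
    obtain v where 2: "b' \<in> carrier R" "t' \<in> S" "v \<in> S"
      and v: "v \<otimes> (t' \<otimes> b) = v \<otimes> (t \<otimes> b')"
      using mem_fracD[OF b' assms(3,4)] by auto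
    note c = 1(1) 2(1) 1(2,3)[THEN S_carr] 2(2,3)[THEN S_carr] assms(1,3) assms(2,4)[THEN S_carr]
    have "u \<otimes> v \<otimes> (s' \<otimes> t' \<otimes> (a \<otimes> t \<oplus> b \<otimes> s)) =
        (u \<otimes> (s' \<otimes> a)) \<otimes> (v \<otimes> t' \<otimes> t) \<oplus> (v \<otimes> (t' \<otimes> b)) \<otimes> (u \<otimes> s' \<otimes> s)"
      using c by (simp add: diff_simps)
    also have "\<dots> = u \<otimes> v \<otimes> (s \<otimes> t \<otimes> (a' \<otimes> t' \<oplus> b' \<otimes> s'))"
      unfolding u v using c by (simp add: diff_simps)
    finally have "u \<otimes> v \<otimes> (s' \<otimes> t' \<otimes> (a \<otimes> t \<oplus> b \<otimes> s)) =
      u \<otimes> v \<otimes> (s \<otimes> t \<otimes> (a' \<otimes> t' \<oplus> b' \<otimes> s'))" .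
    then show "frac (a' \<otimes> t' \<oplus> b' \<otimes> s') (s' \<otimes> t') = frac (a \<otimes> t \<oplus> b \<otimes> s) (s \<otimes> t)"
      using 1 2 c mult_S assms by (subst frac_eq_iff) (auto intro!: bexI[of _ "u \<otimes> v"])
  qed
  then show ?thesis by (simp add: localization_def)
qed

lemma one_Loc: "\<one>\<^bsub>Loc\<^esub> = frac \<one> \<one>" and zero_Loc: "\<zero>\<^bsub>Loc\<^esub> = frac \<zero> \<one>"
  by (simp_all add: localization_def)

lemma cring_Loc: "cring Loc"
proof (rule cringI)
  show "abelian_group Loc"
  proof (rule abelian_groupI)
    fix x y assume "x \<in> carrier Loc" "y \<in> carrier Loc"
    then obtain a s b t where *: "a \<in> carrier R" "s \<in> S" "x = frac a s"
      "b \<in> carrier R" "t \<in> S" "y = frac b t" by (metis frac_cases)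
    then show "x \<oplus>\<^bsub>Loc\<^esub> y \<in> carrier Loc"
      using S_carr mult_S by (simp add: add_frac frac_in_carrier)
    show "x \<oplus>\<^bsub>Loc\<^esub> y = y \<oplus>\<^bsub>Loc\<^esub> x"
      using * S_carr by (simp add: add_frac a_comm m_comm)
    fix z assume "z \<in> carrier Loc"
    then obtain c r where **: "c \<in> carrier R" "r \<in> S" "z = frac c r" by (metis frac_cases)
    note c = *(1,4) **(1) *(2,5)[THEN S_carr] **(2)[THEN S_carr]
    have "(a \<otimes> t \<oplus> b \<otimes> s) \<otimes> r \<oplus> c \<otimes> (s \<otimes> t) = a \<otimes> (t \<otimes> r) \<oplus> (b \<otimes> r \<oplus> c \<otimes> t) \<otimes> s"
      using c by (simp add: diff_simps)
    then show "(x \<oplus>\<^bsub>Loc\<^esub> y) \<oplus>\<^bsub>Loc\<^esub> z = x \<oplus>\<^bsub>Loc\<^esub> (y \<oplus>\<^bsub>Loc\<^esub> z)"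
      using * ** S_carr mult_S by (simp add: add_frac m_assoc)
  next
    show "\<zero>\<^bsub>Loc\<^esub> \<in> carrier Loc" using one_S by (simp add: zero_Loc frac_in_carrier)
  next
    fix x assume "x \<in> carrier Loc"
    then obtain a s where *: "a \<in> carrier R" "s \<in> S" "x = frac a s" by (metis frac_cases)
    then show "\<zero>\<^bsub>Loc\<^esub> \<oplus>\<^bsub>Loc\<^esub> x = x"
      using one_S S_carr by (simp add: zero_Loc add_frac)
    have "frac (\<ominus> a) s \<oplus>\<^bsub>Loc\<^esub> x = frac (\<ominus> a \<otimes> s \<oplus> a \<otimes> s) (s \<otimes> s)"
      using * by (simp add: add_frac)
    also have "\<dots> = \<zero>\<^bsub>Loc\<^esub>"
      unfolding zero_Loc using * S_carr one_S mult_S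
      by (intro frac_eqI) (auto simp: l_minus l_neg)
    finally show "\<exists>y\<in>carrier Loc. y \<oplus>\<^bsub>Loc\<^esub> x = \<zero>\<^bsub>Loc\<^esub>"
      using * by (intro bexI[of _ "frac (\<ominus> a) s"]) (auto simp: frac_in_carrier)
  qed
  show "comm_monoid Loc"
  proof (rule comm_monoidI)
    fix x y assume "x \<in> carrier Loc" "y \<in> carrier Loc"
    then obtain a s b t where *: "a \<in> carrier R" "s \<in> S" "x = frac a s"
      "b \<in> carrier R" "t \<in> S" "y = frac b t" by (metis frac_cases)
    then show "x \<otimes>\<^bsub>Loc\<^esub> y \<in> carrier Loc"
      using S_carr mult_S by (simp add: mult_frac frac_in_carrier)
    show "x \<otimes>\<^bsub>Loc\<^esub> y = y \<otimes>\<^bsub>Loc\<^esub> x"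
      using * S_carr by (simp add: mult_frac m_comm)
    fix z assume "z \<in> carrier Loc"
    then obtain c r where **: "c \<in> carrier R" "r \<in> S" "z = frac c r" by (metis frac_cases)
    then show "(x \<otimes>\<^bsub>Loc\<^esub> y) \<otimes>\<^bsub>Loc\<^esub> z = x \<otimes>\<^bsub>Loc\<^esub> (y \<otimes>\<^bsub>Loc\<^esub> z)"
      using * S_carr mult_S by (simp add: mult_frac m_assoc)
  next
    show "\<one>\<^bsub>Loc\<^esub> \<in> carrier Loc" using one_S by (simp add: one_Loc frac_in_carrier)
  next
    fix x assume "x \<in> carrier Loc"
    then obtain a s where *: "a \<in> carrier R" "s \<in> S" "x = frac a s" by (metis frac_cases)
    then show "\<one>\<^bsub>Loc\<^esub> \<otimes>\<^bsub>Loc\<^esub> x = x"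
      using one_S S_carr by (simp add: one_Loc mult_frac)
  qed
  fix x y z assume "x \<in> carrier Loc" "y \<in> carrier Loc" "z \<in> carrier Loc"
  then obtain a s b t c r where *: "a \<in> carrier R" "b \<in> carrier R" "c \<in> carrier R"
    "s \<in> S" "t \<in> S" "r \<in> S" "x = frac a s" "y = frac b t" "z = frac c r"
    by (metis frac_cases)
  note c = *(1-3) *(4-6)[THEN S_carr]
  have "s \<otimes> r \<otimes> (t \<otimes> r) \<otimes> ((a \<otimes> t \<oplus> b \<otimes> s) \<otimes> c) =
      s \<otimes> t \<otimes> r \<otimes> (a \<otimes> c \<otimes> (t \<otimes> r) \<oplus> b \<otimes> c \<otimes> (s \<otimes> r))"
    using c by (simp add: diff_simps)
  then show "(x \<oplus>\<^bsub>Loc\<^esub> y) \<otimes>\<^bsub>Loc\<^esub> z = x \<otimes>\<^bsub>Loc\<^esub> z \<oplus>\<^bsub>Loc\<^esub> y \<otimes>\<^bsub>Loc\<^esub> z"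
    using * c mult_S by (simp add: mult_frac add_frac) (rule frac_eqI; simp)
qed

sublocale Loc: cring Loc
  by (rule cring_Loc)

lemma frac_zero_iff:
  assumes "a \<in> carrier R" "s \<in> S"
  shows "frac a s = \<zero>\<^bsub>Loc\<^esub> \<longleftrightarrow> (\<exists>u\<in>S. u \<otimes> a = \<zero>)"
  unfolding zero_Loc using assms one_S S_carr by (subst frac_eq_iff) auto

lemma frac_hom: "(\<lambda>a. frac a \<one>) \<in> ring_hom R Loc"
  using one_S by (intro ring_hom_memI) (auto simp: frac_in_carrier mult_frac add_frac one_Loc)

sublocale frac_hom: ring_hom_cring R Loc "\<lambda>a. frac a \<one>"
  using frac_hom cring_Loc is_cring
  by (simp add: ring_hom_cring_def ring_hom_cring_axioms_def)

end

section \<open>Normality without fractions\<close>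

text \<open>The elements \<open>c\<^sub>1 a\<^sup>n\<^sup>-\<^sup>1 b + c\<^sub>2 a\<^sup>n\<^sup>-\<^sup>2 b\<^sup>2 + \<dots> + c\<^sub>n b\<^sup>n\<close>.\<close>

primrec lower_forms :: "('a, 'b) ring_scheme \<Rightarrow> 'a \<Rightarrow> 'a \<Rightarrow> nat \<Rightarrow> 'a set" where
  "lower_forms R a b 0 = {\<zero>\<^bsub>R\<^esub>}"
| "lower_forms R a b (Suc n) =
    {c \<otimes>\<^bsub>R\<^esub> a [^]\<^bsub>R\<^esub> n \<otimes>\<^bsub>R\<^esub> b \<oplus>\<^bsub>R\<^esub> b \<otimes>\<^bsub>R\<^esub> t | c t. c \<in> carrier R \<and> t \<in> lower_forms R a b n}"

text \<open>An equation \<open>a\<^sup>n = c\<^sub>1 a\<^sup>n\<^sup>-\<^sup>1 b + \<dots> + c\<^sub>n b\<^sup>n\<close> says that \<open>a / b\<close> is integral.\<close>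

definition integral_quotient :: "('a, 'b) ring_scheme \<Rightarrow> 'a \<Rightarrow> 'a \<Rightarrow> bool" where
  "integral_quotient R a b \<longleftrightarrow> (\<exists>n. a [^]\<^bsub>R\<^esub> n \<in> lower_forms R a b n)"

context cring begin

lemma lower_forms_closed:
  assumes "a \<in> carrier R" "b \<in> carrier R" "t \<in> lower_forms R a b n"
  shows "t \<in> carrier R"
  using assms(3) by (induction n arbitrary: t) (use assms in auto)

lemma lower_forms_smult:
  assumes "a \<in> carrier R" "b \<in> carrier R" "r \<in> carrier R" "t \<in> lower_forms R a b n"
  shows "r \<otimes> t \<in> lower_forms R a b n"
  using assms(4)
proof (induction n arbitrary: t)
  case (Suc n)
  then obtain c t' where t: "t = c \<otimes> a [^] n \<otimes> b \<oplus> b \<otimes> t'" and c: "c \<in> carrier R"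
    and t': "t' \<in> lower_forms R a b n" by auto
  have t'R: "t' \<in> carrier R" using lower_forms_closed assms t' by blast
  have "r \<otimes> t = (r \<otimes> c) \<otimes> a [^] n \<otimes> b \<oplus> b \<otimes> (r \<otimes> t')"
    unfolding t using assms(1-3) c t'R by (simp add: r_distr m_ac)
  then show ?case using Suc.IH[OF t'] c assms(3) by auto
qed (use assms in simp)

lemma lower_forms_minus:
  assumes "a \<in> carrier R" "b \<in> carrier R" "t \<in> lower_forms R a b n"
  shows "\<ominus> t \<in> lower_forms R a b n"
  using lower_forms_smult[OF assms(1,2), of "\<ominus> \<one>" t n] lower_forms_closed[OF assms] assms
  by (simp add: l_minus)

text \<open>The elements of \<open>lower_forms R a b n\<close> are homogeneous of degree
  \<open>n\<close> in \<open>a\<close> and \<open>b\<close> together.\<close>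

lemma lower_forms_scale_both:
  assumes "a \<in> carrier R" "b \<in> carrier R" "v \<in> carrier R" "t \<in> lower_forms R a b n"
  shows "v [^] n \<otimes> t \<in> lower_forms R (v \<otimes> a) (v \<otimes> b) n"
  using assms(4)
proof (induction n arbitrary: t)
  case (Suc n)
  then obtain c t' where t: "t = c \<otimes> a [^] n \<otimes> b \<oplus> b \<otimes> t'" and c: "c \<in> carrier R"
    and t': "t' \<in> lower_forms R a b n" by auto
  have t'R: "t' \<in> carrier R" using lower_forms_closed assms t' by blast
  have "v [^] Suc n \<otimes> t =
      c \<otimes> (v \<otimes> a) [^] n \<otimes> (v \<otimes> b) \<oplus> (v \<otimes> b) \<otimes> (v [^] n \<otimes> t')"
    unfolding t using assms(1-3) c t'R by (simp add: r_distr m_ac nat_pow_distrib)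
  then show ?case using Suc.IH[OF t'] c by auto
qed (use assms in simp)

text \<open>Each term of a form of degree \<open>n + 1\<close> contains \<open>b\<close>, so its
  degree in \<open>a\<close> is at most \<open>n\<close>. Hence \<open>u [^] n\<close> supplies a
  factor \<open>u\<close> for every \<open>a\<close>, and surplus factors go into the
  coefficients.\<close>

lemma lower_forms_scale_left:
  assumes "a \<in> carrier R" "b \<in> carrier R" "u \<in> carrier R" "t \<in> lower_forms R a b (Suc n)"
  shows "u [^] n \<otimes> t \<in> lower_forms R (u \<otimes> a) b (Suc n)"
  using assms(4)
proof (induction n arbitrary: t)
  case 0
  then show ?case using assms lower_forms_closed[of a b t "Suc 0"] by auto
next
  case (Suc n)
  then obtain c t' where t: "t = c \<otimes> a [^] Suc n \<otimes> b \<oplus> b \<otimes> t'" and c: "c \<in> carrier R"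
    and t': "t' \<in> lower_forms R a b (Suc n)" by auto
  have t'R: "t' \<in> carrier R" using lower_forms_closed assms t' by blast
  have "u [^] Suc n \<otimes> t =
      c \<otimes> (u \<otimes> a) [^] Suc n \<otimes> b \<oplus> b \<otimes> (u \<otimes> (u [^] n \<otimes> t'))"
    unfolding t using assms(1-3) c t'R by (simp add: r_distr m_ac nat_pow_distrib)
  moreover have "u \<otimes> (u [^] n \<otimes> t') \<in> lower_forms R (u \<otimes> a) b (Suc n)"
    by (rule lower_forms_smult[OF _ assms(2,3) Suc.IH[OF t']]) (use assms in simp)
  ultimately show ?case unfolding lower_forms.simps(2)[of R "u \<otimes> a" b "Suc n"] using c by blast
qed

end

lemma (in ring_hom_cring) hom_nat_pow:
  "a \<in> carrier R \<Longrightarrow> h (a [^] (n :: nat)) = h a [^]\<^bsub>S\<^esub> n"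
  by (induction n) auto

lemma (in ring_hom_cring) lower_forms_hom:
  assumes "a \<in> carrier R" "b \<in> carrier R" "t \<in> lower_forms R a b n"
  shows "h t \<in> lower_forms S (h a) (h b) n"
  using assms(3)
proof (induction n arbitrary: t)
  case (Suc n)
  then obtain c t' where t: "t = c \<otimes> a [^] n \<otimes> b \<oplus> b \<otimes> t'" and c: "c \<in> carrier R"
    and t': "t' \<in> lower_forms R a b n" by auto
  have "t' \<in> carrier R" using R.lower_forms_closed assms t' by blast
  then have "h t = h c \<otimes>\<^bsub>S\<^esub> h a [^]\<^bsub>S\<^esub> n \<otimes>\<^bsub>S\<^esub> h b \<oplus>\<^bsub>S\<^esub> h b \<otimes>\<^bsub>S\<^esub> h t'"
    unfolding t using assms(1,2) c by (simp add: hom_nat_pow)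
  then show ?case using Suc.IH[OF t'] c by auto
qed simp

section \<open>Clearing denominators\<close>

context multiplicative_subset begin

text \<open>Elements of \<open>S\<close> may be zero divisors in \<open>R\<close>, but they are
  cancellable in the localization: a witness \<open>u\<close> that kills \<open>s c\<close> yields
  the witness \<open>u s\<close> that kills \<open>c\<close>.\<close>

lemma frac_mult_cancel:
  assumes "s \<in> S" "y \<in> carrier Loc" "frac s \<one> \<otimes>\<^bsub>Loc\<^esub> y = \<zero>\<^bsub>Loc\<^esub>"
  shows "y = \<zero>\<^bsub>Loc\<^esub>"
proof -
  obtain c r where y: "c \<in> carrier R" "r \<in> S" "y = frac c r" using assms(2) by (rule frac_cases)
  then have "frac (s \<otimes> c) r = \<zero>\<^bsub>Loc\<^esub>"
    using assms one_S S_carr by (simp add: mult_frac)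
  then obtain u where u: "u \<in> S" "u \<otimes> (s \<otimes> c) = \<zero>"
    using y assms S_carr by (auto simp: frac_zero_iff)
  then have "(u \<otimes> s) \<otimes> c = \<zero>" using y assms S_carr by (simp add: m_assoc)
  then show ?thesis using u y assms mult_S by (auto simp: frac_zero_iff)
qed

lemma frac_mult_denom:
  assumes "a \<in> carrier R" "s \<in> S" "r \<in> carrier R"
  shows "frac (r \<otimes> s) \<one> \<otimes>\<^bsub>Loc\<^esub> frac a s = frac (r \<otimes> a) \<one>"
proof -
  have c: "s \<in> carrier R" "r \<otimes> s \<in> carrier R" using assms S_carr by auto
  have "frac (r \<otimes> s) \<one> \<otimes>\<^bsub>Loc\<^esub> frac a s = frac (r \<otimes> s \<otimes> a) (\<one> \<otimes> s)"
    using mult_frac[OF c(2) one_S assms(1,2)] .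
  also have "\<dots> = frac (r \<otimes> a) \<one>"
    using assms c one_S mult_S by (intro frac_eqI) (simp_all add: m_ac)
  finally show ?thesis .
qed

lemma frac_pow_denom:
  assumes "a \<in> carrier R" "s \<in> S"
  shows "frac (s [^] n) \<one> \<otimes>\<^bsub>Loc\<^esub> frac a s [^]\<^bsub>Loc\<^esub> (n :: nat) = frac (a [^] n) \<one>"
proof -
  have c: "frac s \<one> \<in> carrier Loc" "frac a s \<in> carrier Loc"
    using assms S_carr one_S by (auto intro: frac_in_carrier)
  have "frac (s [^] n) \<one> \<otimes>\<^bsub>Loc\<^esub> frac a s [^]\<^bsub>Loc\<^esub> n =
      (frac s \<one> \<otimes>\<^bsub>Loc\<^esub> frac a s) [^]\<^bsub>Loc\<^esub> n"
    using assms S_carr c by (simp add: frac_hom.hom_nat_pow Loc.nat_pow_distrib)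
  also have "frac s \<one> \<otimes>\<^bsub>Loc\<^esub> frac a s = frac a \<one>"
    using frac_mult_denom[OF assms, of \<one>] assms S_carr by simp
  finally show ?thesis using assms by (simp add: frac_hom.hom_nat_pow)
qed

text \<open>A form has finitely many coefficients, so the product of their denominators moves it
  into \<open>R\<close>. This brings integral equations over the localization down to
  \<open>R\<close>.\<close>

lemma lower_forms_Loc_clear_denom:
  assumes "a \<in> carrier R" "b \<in> carrier R" "t \<in> lower_forms Loc (frac a \<one>) (frac b \<one>) n"
  shows "\<exists>u\<in>S. \<exists>t'\<in>lower_forms R a b n. frac u \<one> \<otimes>\<^bsub>Loc\<^esub> t = frac t' \<one>"
  using assms(3)
proof (induction n arbitrary: t)
  case 0
  then show ?case using one_S by (auto simp: intro!: bexI[of _ \<one>] simp flip: zero_Loc one_Loc)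
next
  case (Suc n)
  then obtain c t1 where t: "t = c \<otimes>\<^bsub>Loc\<^esub> frac a \<one> [^]\<^bsub>Loc\<^esub> n \<otimes>\<^bsub>Loc\<^esub> frac b \<one> \<oplus>\<^bsub>Loc\<^esub> frac b \<one> \<otimes>\<^bsub>Loc\<^esub> t1"
    and c: "c \<in> carrier Loc" and t1: "t1 \<in> lower_forms Loc (frac a \<one>) (frac b \<one>) n" by auto
  obtain d s where d: "d \<in> carrier R" "s \<in> S" "c = frac d s" using c by (rule frac_cases)
  obtain u t1' where u: "u \<in> S" "t1' \<in> lower_forms R a b n"
    and ut1: "frac u \<one> \<otimes>\<^bsub>Loc\<^esub> t1 = frac t1' \<one>"
    using Suc.IH[OF t1] by auto
  have t1R: "t1 \<in> carrier Loc" "t1' \<in> carrier R"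
    using lower_forms_closed[OF assms(1,2) u(2)] Loc.lower_forms_closed[OF _ _ t1] assms by auto
  have sR: "s \<in> carrier R" "u \<in> carrier R" using d u S_carr by auto
  let ?f = "\<lambda>x. frac x \<one>"
  let ?A = "?f a [^]\<^bsub>Loc\<^esub> n"
  have A: "?A = ?f (a [^] n)" using assms by (simp add: frac_hom.hom_nat_pow)
  have fc: "?f x \<in> carrier Loc" if "x \<in> carrier R" for x using that by simp
  have "?f (u \<otimes> s) \<otimes>\<^bsub>Loc\<^esub> t =
      ?f (u \<otimes> s) \<otimes>\<^bsub>Loc\<^esub> c \<otimes>\<^bsub>Loc\<^esub> ?A \<otimes>\<^bsub>Loc\<^esub> ?f b
      \<oplus>\<^bsub>Loc\<^esub> ?f b \<otimes>\<^bsub>Loc\<^esub> (?f s \<otimes>\<^bsub>Loc\<^esub> (?f u \<otimes>\<^bsub>Loc\<^esub> t1))"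
    unfolding t using assms sR t1R c by (simp add: Loc.r_distr Loc.m_ac)
  also have "\<dots> = ?f ((u \<otimes> d) \<otimes> a [^] n \<otimes> b \<oplus> b \<otimes> (s \<otimes> t1'))"
    unfolding ut1 d(3) frac_mult_denom[OF d(1,2) sR(2)] A using assms sR t1R d(1) by simp
  finally have "?f (u \<otimes> s) \<otimes>\<^bsub>Loc\<^esub> t = ?f ((u \<otimes> d) \<otimes> a [^] n \<otimes> b \<oplus> b \<otimes> (s \<otimes> t1'))" .
  moreover have "(u \<otimes> d) \<otimes> a [^] n \<otimes> b \<oplus> b \<otimes> (s \<otimes> t1') \<in> lower_forms R a b (Suc n)"
    using lower_forms_smult[OF assms(1,2) sR(1) u(2)] sR d(1) by auto
  ultimately show ?case using mult_S u d by blast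
qed

lemma domain_Loc:
  assumes "domain R" "\<zero> \<notin> S"
  shows "domain Loc"
proof -
  interpret D: domain R by fact
  have nz: "frac a s = \<zero>\<^bsub>Loc\<^esub> \<longleftrightarrow> a = \<zero>" if "a \<in> carrier R" "s \<in> S" for a s
    using that assms(2) S_carr one_S by (auto simp: frac_zero_iff D.integral_iff)
  show ?thesis
  proof (rule domain.intro[OF cring_Loc], rule domain_axioms.intro)
    show "\<one>\<^bsub>Loc\<^esub> \<noteq> \<zero>\<^bsub>Loc\<^esub>" 
      using nz[OF one_closed one_S] by (simp add: one_Loc del: frac_hom.hom_one)
    fix x y assume xy: "x \<otimes>\<^bsub>Loc\<^esub> y = \<zero>\<^bsub>Loc\<^esub>" "x \<in> carrier Loc" "y \<in> carrier Loc"
    then obtain a s b t where *: "a \<in> carrier R" "s \<in> S" "x = frac a s"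
      "b \<in> carrier R" "t \<in> S" "y = frac b t" by (metis frac_cases)
    then show "x = \<zero>\<^bsub>Loc\<^esub> \<or> y = \<zero>\<^bsub>Loc\<^esub>"
      using xy nz mult_S by (simp add: mult_frac D.integral_iff)
  qed
qed

text \<open>The polynomial \<open>cs\<close> has degree below its length \<open>n\<close>, so the
  factor \<open>b [^] n\<close> clears the denominators of its value at \<open>a / b\<close> and
  leaves at least one \<open>b\<close> in every term.\<close>

lemma eval_lower_forms:
  assumes "a \<in> carrier R" "b \<in> S" "set cs \<subseteq> (\<lambda>a. frac a \<one>) ` carrier R"
  shows "\<exists>t\<in>lower_forms R a b (length cs).
    frac (b [^] length cs) \<one> \<otimes>\<^bsub>Loc\<^esub> Loc.eval cs (frac a b) = frac t \<one>"
  using assms(3)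
proof (induction cs)
  case Nil
  then show ?case by (simp flip: zero_Loc one_Loc)
next
  case (Cons c cs)
  let ?n = "length cs" and ?x = "frac a b" and ?f = "\<lambda>x. frac x \<one>"
  have bR: "b \<in> carrier R" using assms S_carr by auto
  obtain d where d: "d \<in> carrier R" "c = ?f d" using Cons.prems by auto
  obtain t where t: "t \<in> lower_forms R a b ?n"
    "?f (b [^] ?n) \<otimes>\<^bsub>Loc\<^esub> Loc.eval cs ?x = ?f t"
    using Cons by auto
  have tR: "t \<in> carrier R" using lower_forms_closed t assms bR by blast
  have xL: "?x \<in> carrier Loc" using assms by (simp add: frac_in_carrier)
  have eL: "Loc.eval cs ?x \<in> carrier Loc"
    using Cons.prems xL by (intro Loc.eval_in_carrier) auto
  have "?f (b [^] Suc ?n) \<otimes>\<^bsub>Loc\<^esub> Loc.eval (c # cs) ?x =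
      ?f d \<otimes>\<^bsub>Loc\<^esub> (?f (b [^] ?n) \<otimes>\<^bsub>Loc\<^esub> ?x [^]\<^bsub>Loc\<^esub> ?n) \<otimes>\<^bsub>Loc\<^esub> ?f b
      \<oplus>\<^bsub>Loc\<^esub> ?f b \<otimes>\<^bsub>Loc\<^esub> (?f (b [^] ?n) \<otimes>\<^bsub>Loc\<^esub> Loc.eval cs ?x)"
    using d bR xL eL by (simp add: Loc.r_distr Loc.m_ac)
  also have "\<dots> = ?f (d \<otimes> a [^] ?n \<otimes> b \<oplus> b \<otimes> t)"
    unfolding t(2) frac_pow_denom[OF assms(1,2)] using d bR assms tR by simp
  finally show ?case using t(1) d(1) by auto
qed

text \<open>Converse of \<open>eval_lower_forms\<close>. The coefficient list has exactly
  \<open>n\<close> entries and may start with zeros; it becomes a polynomial once a leading one is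
  put in front.\<close>

lemma lower_forms_eval:
  assumes "a \<in> carrier R" "b \<in> S" "t \<in> lower_forms R a b n"
  shows "\<exists>cs. length cs = n \<and> set cs \<subseteq> (\<lambda>a. frac a \<one>) ` carrier R \<and>
    frac (b [^] n) \<one> \<otimes>\<^bsub>Loc\<^esub> Loc.eval cs (frac a b) = frac t \<one>"
  using assms(3)
proof (induction n arbitrary: t)
  case 0
  then show ?case by (simp flip: zero_Loc one_Loc)
next
  case (Suc n)
  let ?x = "frac a b" and ?f = "\<lambda>x. frac x \<one>"
  have bR: "b \<in> carrier R" using assms S_carr by auto
  obtain d t' where t: "t = d \<otimes> a [^] n \<otimes> b \<oplus> b \<otimes> t'" and d: "d \<in> carrier R"
    and t': "t' \<in> lower_forms R a b n" using Suc.prems by auto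
  obtain cs where cs: "length cs = n" "set cs \<subseteq> ?f ` carrier R"
    "?f (b [^] n) \<otimes>\<^bsub>Loc\<^esub> Loc.eval cs ?x = ?f t'"
    using Suc.IH[OF t'] by auto
  have tR: "t' \<in> carrier R" using lower_forms_closed t' assms bR by blast
  have xL: "?x \<in> carrier Loc" using assms by (simp add: frac_in_carrier)
  have eL: "Loc.eval cs ?x \<in> carrier Loc"
    using cs xL by (intro Loc.eval_in_carrier) auto
  have "?f (b [^] Suc n) \<otimes>\<^bsub>Loc\<^esub> Loc.eval (?f d # cs) ?x =
      ?f d \<otimes>\<^bsub>Loc\<^esub> (?f (b [^] n) \<otimes>\<^bsub>Loc\<^esub> ?x [^]\<^bsub>Loc\<^esub> n) \<otimes>\<^bsub>Loc\<^esub> ?f b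
      \<oplus>\<^bsub>Loc\<^esub> ?f b \<otimes>\<^bsub>Loc\<^esub> (?f (b [^] n) \<otimes>\<^bsub>Loc\<^esub> Loc.eval cs ?x)"
    using d bR xL eL cs(1) by (simp add: Loc.r_distr Loc.m_ac)
  also have "\<dots> = ?f t"
    unfolding cs(3) frac_pow_denom[OF assms(1,2)] t using d bR assms tR by simp
  finally show ?case using cs(1,2) d by (intro exI[of _ "?f d # cs"]) auto
qed

end

lemma (in domain) multiplicative_subset_nonzero: "multiplicative_subset R (carrier R - {\<zero>})"
  by unfold_locales (auto simp: integral_iff)

text \<open>A monic polynomial is split into its leading one and the rest \<open>cs\<close> of
  length \<open>n\<close>. Multiplied by \<open>b [^] n\<close>, its value at \<open>a / b\<close>
  becomes the image of \<open>a [^] n \<oplus> t\<close> with \<open>t\<close> a lower form. Since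
  \<open>b [^] n\<close> is cancellable and \<open>R\<close> embeds into its field of fractions, the
  value vanishes exactly if \<open>a [^] n = \<ominus> t\<close>.\<close>

lemma (in domain) integral_over_iff:
  assumes "a \<in> carrier R" "b \<in> carrier R - {\<zero>}"
  defines "F \<equiv> fraction R (carrier R - {\<zero>})"
  shows "integral_over (fraction_field R) ((\<lambda>a. F a \<one>) ` carrier R) (F a b)
    \<longleftrightarrow> integral_quotient R a b"
proof -
  interpret M: multiplicative_subset R "carrier R - {\<zero>}" by (rule multiplicative_subset_nonzero)
  interpret L: domain M.Loc using M.domain_Loc domain_axioms by blast
  let ?x = "F a b" and ?f = "\<lambda>x. F x \<one>"
  have bR: "b \<in> carrier R" using assms by auto
  have xL: "?x \<in> carrier M.Loc" unfolding F_def using assms by (intro M.frac_in_carrier)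
  have fL: "?f c \<in> carrier M.Loc" if "c \<in> carrier R" for c unfolding F_def using that by simp
  have inj: "c = \<zero>" if "c \<in> carrier R" "?f c = \<zero>\<^bsub>M.Loc\<^esub>" for c
    using that unfolding F_def by (auto simp: M.frac_zero_iff integral_iff)
  have pw: "?f (b [^] n) \<otimes>\<^bsub>M.Loc\<^esub> ?x [^]\<^bsub>M.Loc\<^esub> n = ?f (a [^] n)" for n :: nat
    unfolding F_def using M.frac_pow_denom assms by simp
  have bn: "b [^] n \<in> carrier R - {\<zero>}" for n :: nat
    using assms by (induction n) (auto simp: integral_iff)
  have key: "?f (b [^] n) \<otimes>\<^bsub>M.Loc\<^esub> M.Loc.eval (\<one>\<^bsub>M.Loc\<^esub> # cs) ?x = ?f (a [^] n \<oplus> t)"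
    if "length cs = n" "set cs \<subseteq> ?f ` carrier R" "t \<in> carrier R"
      "?f (b [^] n) \<otimes>\<^bsub>M.Loc\<^esub> M.Loc.eval cs ?x = ?f t" for cs n t
  proof -
    have "M.Loc.eval cs ?x \<in> carrier M.Loc"
      using that(2) fL xL by (intro M.Loc.eval_in_carrier) auto
    then have "?f (b [^] n) \<otimes>\<^bsub>M.Loc\<^esub> M.Loc.eval (\<one>\<^bsub>M.Loc\<^esub> # cs) ?x =
        ?f (b [^] n) \<otimes>\<^bsub>M.Loc\<^esub> ?x [^]\<^bsub>M.Loc\<^esub> n \<oplus>\<^bsub>M.Loc\<^esub> ?f (b [^] n) \<otimes>\<^bsub>M.Loc\<^esub> M.Loc.eval cs ?x"
      using that(1) bR fL xL by (simp add: M.Loc.r_distr)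
    also have "\<dots> = ?f (a [^] n \<oplus> t)"
      unfolding that(4) pw using assms(1) that(3) by (simp add: F_def)
    finally show ?thesis .
  qed
  show ?thesis
  proof
    assume "integral_over (fraction_field R) (?f ` carrier R) ?x"
    then obtain f where f: "polynomial\<^bsub>M.Loc\<^esub> (?f ` carrier R) f" "f \<noteq> []"
      "lead_coeff f = \<one>\<^bsub>M.Loc\<^esub>" "M.Loc.eval f ?x = \<zero>\<^bsub>M.Loc\<^esub>"
      by (auto simp: integral_over_def fraction_field_def)
    then obtain cs where fcs: "f = \<one>\<^bsub>M.Loc\<^esub> # cs" by (cases f) auto
    have cs: "set cs \<subseteq> ?f ` carrier R" using f(1) unfolding fcs by (auto simp: polynomial_def)
    then obtain t where t: "t \<in> lower_forms R a b (length cs)"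
      "?f (b [^] length cs) \<otimes>\<^bsub>M.Loc\<^esub> M.Loc.eval cs ?x = ?f t"
      using M.eval_lower_forms[OF assms(1,2)] unfolding F_def by blast
    have tR: "t \<in> carrier R" using lower_forms_closed t(1) assms(1) bR by blast
    have "?f (a [^] length cs \<oplus> t) = \<zero>\<^bsub>M.Loc\<^esub>"
      using key[OF refl cs tR t(2)] f(4) fL bR by (simp add: fcs)
    then have "a [^] length cs = \<ominus> t"
      using inj[of "a [^] length cs \<oplus> t"] assms(1) tR
      by (metis a_closed add.inv_equality nat_pow_closed)
    then show "integral_quotient R a b"
      using lower_forms_minus[OF assms(1) bR t(1)] unfolding integral_quotient_def by metis
  next
    assume "integral_quotient R a b"
    then obtain n where n: "a [^] n \<in> lower_forms R a b n" by (auto simp: integral_quotient_def)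
    have m: "\<ominus> (a [^] n) \<in> lower_forms R a b n" using lower_forms_minus[OF assms(1) bR n] .
    have "\<exists>cs. length cs = n \<and> set cs \<subseteq> ?f ` carrier R \<and>
        ?f (b [^] n) \<otimes>\<^bsub>M.Loc\<^esub> M.Loc.eval cs ?x = ?f (\<ominus> (a [^] n))"
      unfolding F_def by (rule M.lower_forms_eval[OF assms(1,2) m])
    then obtain cs where cs: "length cs = n" "set cs \<subseteq> ?f ` carrier R"
      "?f (b [^] n) \<otimes>\<^bsub>M.Loc\<^esub> M.Loc.eval cs ?x = ?f (\<ominus> (a [^] n))"
      by (elim exE conjE)
    have "?f (b [^] n) \<otimes>\<^bsub>M.Loc\<^esub> M.Loc.eval (\<one>\<^bsub>M.Loc\<^esub> # cs) ?x = \<zero>\<^bsub>M.Loc\<^esub>"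
      using key[OF cs(1,2) _ cs(3)] assms(1) by (simp add: r_neg F_def M.frac_hom.hom_zero)
    moreover have "M.Loc.eval (\<one>\<^bsub>M.Loc\<^esub> # cs) ?x \<in> carrier M.Loc"
      using cs(2) fL xL by (intro M.Loc.eval_in_carrier) auto
    ultimately have "M.Loc.eval (\<one>\<^bsub>M.Loc\<^esub> # cs) ?x = \<zero>\<^bsub>M.Loc\<^esub>"
      using M.frac_mult_cancel[OF bn] unfolding F_def by blast
    moreover have "polynomial\<^bsub>M.Loc\<^esub> (?f ` carrier R) (\<one>\<^bsub>M.Loc\<^esub> # cs)"
    proof -
      have "\<one>\<^bsub>M.Loc\<^esub> = ?f \<one>" unfolding F_def by (rule M.one_Loc)
      then have "\<one>\<^bsub>M.Loc\<^esub> \<in> ?f ` carrier R" by (rule image_eqI) simp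
      then show ?thesis using cs(2) L.one_not_zero by (simp add: polynomial_def)
    qed
    ultimately show "integral_over (fraction_field R) (?f ` carrier R) ?x"
      unfolding integral_over_def fraction_field_def
      by (intro exI[of _ "\<one>\<^bsub>M.Loc\<^esub> # cs"]) simp
  qed
qed

text \<open>Every element of the field of fractions is some \<open>a / b\<close>, and it lies in
  \<open>R\<close> exactly if \<open>b\<close> divides \<open>a\<close>. From here on normality is
  used only in this form, inside the ring itself.\<close>

lemma normal_domain_iff:
  fixes R (structure)
  shows "normal_domain R \<longleftrightarrow> domain R \<and>
    (\<forall>a\<in>carrier R. \<forall>b\<in>carrier R - {\<zero>}. integral_quotient R a b \<longrightarrow> (\<exists>c\<in>carrier R. a = b \<otimes> c))"
proof (cases "domain R")
  case True
  interpret D: domain R by fact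
  interpret M: multiplicative_subset R "carrier R - {\<zero>}" by (rule D.multiplicative_subset_nonzero)
  let ?K = "(\<lambda>a. M.frac a \<one>) ` carrier R"
  have mem: "M.frac a b \<in> ?K \<longleftrightarrow> (\<exists>c\<in>carrier R. a = b \<otimes> c)"
    if "a \<in> carrier R" "b \<in> carrier R - {\<zero>}" for a b
  proof -
    have "M.frac a b = M.frac c \<one> \<longleftrightarrow> a = b \<otimes> c" if "c \<in> carrier R" for c
      using that \<open>a \<in> carrier R\<close> \<open>b \<in> carrier R - {\<zero>}\<close>
      by (subst M.frac_eq_iff) (auto simp: D.m_lcancel)
    then show ?thesis by auto
  qed
  have "normal_domain R \<longleftrightarrow> (\<forall>x\<in>carrier M.Loc. integral_over (fraction_field R) ?K x \<longrightarrow> x \<in> ?K)"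
    using True by (auto simp: normal_domain_def normal_domain_axioms_def fraction_field_def)
  also have "\<dots> \<longleftrightarrow> (\<forall>a\<in>carrier R. \<forall>b\<in>carrier R - {\<zero>}.
      integral_over (fraction_field R) ?K (M.frac a b) \<longrightarrow> M.frac a b \<in> ?K)"
    by (auto intro!: M.frac_in_carrier elim!: M.frac_cases)
  also have "\<dots> \<longleftrightarrow> (\<forall>a\<in>carrier R. \<forall>b\<in>carrier R - {\<zero>}.
      integral_quotient R a b \<longrightarrow> (\<exists>c\<in>carrier R. a = b \<otimes> c))"
    using mem D.integral_over_iff by simp
  finally show ?thesis using True by simp
qed (simp add: normal_domain_def)

section \<open>Localization at a prime and normality\<close>

lemma (in cring) multiplicative_subset_prime:
  assumes "primeideal p R"
  shows "multiplicative_subset R (carrier R - p)"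
proof -
  interpret primeideal p R by fact
  show ?thesis
    using I_notcarr one_imp_carrier by unfold_locales (auto dest: I_prime)
qed

lemma (in cring) localization_at_domainD:
  assumes "primeideal p R" "domain (localization_at R p)"
    and "a \<in> carrier R" "b \<in> carrier R" "a \<otimes> b = \<zero>"
  shows "\<exists>s\<in>carrier R - p. s \<otimes> a = \<zero> \<or> s \<otimes> b = \<zero>"
proof -
  interpret M: multiplicative_subset R "carrier R - p"
    using assms(1) by (rule multiplicative_subset_prime)
  interpret L: domain M.Loc using assms(2) by (simp add: localization_at_def)
  have "M.frac a \<one> \<otimes>\<^bsub>M.Loc\<^esub> M.frac b \<one> = M.frac (a \<otimes> b) \<one>"
    using assms(3,4) by simp
  also have "\<dots> = \<zero>\<^bsub>M.Loc\<^esub>" unfolding assms(5) by (rule M.frac_hom.hom_zero)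
  finally have "M.frac a \<one> = \<zero>\<^bsub>M.Loc\<^esub> \<or> M.frac b \<one> = \<zero>\<^bsub>M.Loc\<^esub>"
    using assms(3,4) by (simp add: L.integral_iff)
  then show ?thesis using M.frac_zero_iff[OF _ M.one_S] assms(3,4) by blast
qed

text \<open>The integral equation of \<open>a / b\<close> passes to the localization, where
  normality makes \<open>b\<close> divide \<open>a\<close>. Clearing the denominator of the quotient
  costs a factor \<open>s\<close> outside \<open>p\<close>.\<close>

lemma (in domain) localization_at_normalD:
  assumes "primeideal p R" "normal_domain (localization_at R p)"
    and "a \<in> carrier R" "b \<in> carrier R" "b \<noteq> \<zero>" "integral_quotient R a b"
  shows "\<exists>s\<in>carrier R - p. \<exists>c\<in>carrier R. s \<otimes> a = b \<otimes> c"
proof -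
  interpret M: multiplicative_subset R "carrier R - p"
    using assms(1) by (rule multiplicative_subset_prime)
  have "\<zero> \<in> p" using assms(1) by (simp add: additive_subgroup.zero_closed ideal_def primeideal_def)
  then have b: "M.frac b \<one> \<noteq> \<zero>\<^bsub>M.Loc\<^esub>"
    using assms(4,5) M.frac_zero_iff[OF _ M.one_S, of b] by (auto simp: integral_iff)
  obtain n where n: "a [^] n \<in> lower_forms R a b n"
    using assms(6) by (auto simp: integral_quotient_def)
  have "integral_quotient M.Loc (M.frac a \<one>) (M.frac b \<one>)"
    using M.frac_hom.lower_forms_hom[OF assms(3,4) n] assms(3)
    unfolding integral_quotient_def by (auto simp: M.frac_hom.hom_nat_pow)
  then obtain y where y: "y \<in> carrier M.Loc" "M.frac a \<one> = M.frac b \<one> \<otimes>\<^bsub>M.Loc\<^esub> y"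
  proof -
    have "M.frac b \<one> \<in> carrier M.Loc - {\<zero>\<^bsub>M.Loc\<^esub>}" "M.frac a \<one> \<in> carrier M.Loc"
      using b assms(3,4) by simp_all
    then show thesis
      using assms(2) that \<open>integral_quotient M.Loc _ _\<close>
      unfolding normal_domain_iff localization_at_def by blast
  qed
  obtain c s where c: "c \<in> carrier R" "s \<in> carrier R - p" "y = M.frac c s"
    using y(1) by (rule M.frac_cases)
  have "M.frac a \<one> = M.frac (b \<otimes> c) (\<one> \<otimes> s)"
    unfolding y(2) c(3) by (rule M.mult_frac[OF assms(4) M.one_S c(1,2)])
  then obtain u where u: "u \<in> carrier R - p" "u \<otimes> (s \<otimes> a) = u \<otimes> (b \<otimes> c)"
    using M.frac_eq_iff[of a \<one> "b \<otimes> c" "\<one> \<otimes> s"] assms(3,4) c M.one_S by auto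
  then have "(u \<otimes> s) \<otimes> a = b \<otimes> (u \<otimes> c)"
    using assms(3,4) c by (simp add: m_ac)
  moreover have "u \<otimes> s \<in> carrier R - p" using u c M.mult_S by blast
  ultimately show ?thesis using c u by blast
qed

text \<open>The easy direction of the theorem. For \<open>x = a / s\<close> and
  \<open>y = b / t\<close> with \<open>x / y\<close> integral, multiplying both by
  \<open>t s\<close> gives numerator \<open>t a\<close> and denominator \<open>s b\<close> in
  \<open>R\<close>. A common denominator \<open>u\<close> of the coefficients makes
  \<open>u t a / (s b)\<close> integral over \<open>R\<close>, so \<open>s b\<close> divides
  \<open>u t a\<close>.\<close>

lemma (in normal_domain) normal_localization_at:
  assumes "primeideal p R"
  shows "normal_domain (localization_at R p)"
proof -
  interpret M: multiplicative_subset R "carrier R - p"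
    using assms by (rule multiplicative_subset_prime)
  have "\<zero> \<in> p" using assms by (simp add: additive_subgroup.zero_closed ideal_def primeideal_def)
  then interpret L: domain M.Loc using M.domain_Loc domain_axioms by blast
  have nz: "s \<noteq> \<zero>" if "s \<in> carrier R - p" for s using that \<open>\<zero> \<in> p\<close> by auto
  have div: "\<exists>c\<in>carrier R. a = b \<otimes> c"
    if "a \<in> carrier R" "b \<in> carrier R" "b \<noteq> \<zero>" "integral_quotient R a b" for a b
    using that normal_domain_axioms unfolding normal_domain_iff by auto
  have "\<exists>z\<in>carrier M.Loc. x = y \<otimes>\<^bsub>M.Loc\<^esub> z"
    if x: "x \<in> carrier M.Loc" and y: "y \<in> carrier M.Loc" "y \<noteq> \<zero>\<^bsub>M.Loc\<^esub>"
      and xy: "integral_quotient M.Loc x y" for x y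
  proof -
    obtain a s where a: "a \<in> carrier R" "s \<in> carrier R - p" "x = M.frac a s"
      using x by (rule M.frac_cases)
    obtain b t where b: "b \<in> carrier R" "t \<in> carrier R - p" "y = M.frac b t"
      using y(1) by (rule M.frac_cases)
    have "b \<noteq> \<zero>" using y(2) M.frac_zero_iff[OF b(1,2)] b M.one_S by force
    let ?f = "\<lambda>a. M.frac a \<one>"
    let ?v = "?f (t \<otimes> s)" and ?a = "t \<otimes> a" and ?b = "s \<otimes> b"
    have c: "?a \<in> carrier R" "?b \<in> carrier R" "?v \<in> carrier M.Loc" "t \<otimes> s \<in> carrier R"
      using a b by auto
    obtain n where n: "x [^]\<^bsub>M.Loc\<^esub> n \<in> lower_forms M.Loc x y n"
      using xy by (auto simp: integral_quotient_def)
    have "?v \<otimes>\<^bsub>M.Loc\<^esub> x = ?f ?a"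
      unfolding a(3) using M.frac_mult_denom[of a s t] a b by simp
    moreover have "?v \<otimes>\<^bsub>M.Loc\<^esub> y = ?f ?b"
      unfolding b(3) using M.frac_mult_denom[of b t s] a b by (simp add: m_comm)
    ultimately have "?f ?a [^]\<^bsub>M.Loc\<^esub> n \<in> lower_forms M.Loc (?f ?a) (?f ?b) n"
      using M.Loc.lower_forms_scale_both[OF x y(1) c(3) n] x c
      by (metis M.Loc.nat_pow_distrib)
    then obtain u t' where u: "u \<in> carrier R - p" and t': "t' \<in> lower_forms R ?a ?b n"
      and "?f u \<otimes>\<^bsub>M.Loc\<^esub> ?f ?a [^]\<^bsub>M.Loc\<^esub> n = ?f t'"
      using M.lower_forms_Loc_clear_denom[OF c(1,2)] by blast
    then have "?f (u \<otimes> ?a [^] n) = ?f t'"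
      using c(1) by (simp add: M.frac_hom.hom_nat_pow del: M.frac_hom.hom_mult
          add: M.frac_hom.hom_mult[of u "?a [^] n"])
    moreover have "t' \<in> carrier R" using lower_forms_closed[OF c(1,2) t'] .
    ultimately have eq: "u \<otimes> ?a [^] n = t'"
      using M.frac_eq_iff[of "u \<otimes> ?a [^] n" \<one> t' \<one>] u c M.one_S nz
      by (auto simp: m_lcancel simp del: nat_pow_closed)
    \<comment> \<open>The only form of degree 0 is zero, so \<open>n = 0\<close> would force
      \<open>u = \<zero>\<close>.\<close>
    have "n \<noteq> 0"
    proof
      assume "n = 0"
      then have "u = \<zero>" using eq t' u by simp
      then show False using nz u by blast
    qed
    then obtain k where k: "n = Suc k" by (cases n) auto
    \<comment> \<open>So far \<open>u\<close> multiplies only the leading term. Another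
      \<open>u [^] k\<close> completes it to the power of \<open>u \<otimes> ?a\<close>, and the
      lower terms absorb that factor.\<close>
    have "u [^] k \<otimes> (u \<otimes> ?a [^] Suc k) \<in> lower_forms R (u \<otimes> ?a) ?b (Suc k)"
      using lower_forms_scale_left[OF c(1,2)] t' u unfolding eq[symmetric] k by auto
    also have "u [^] k \<otimes> (u \<otimes> ?a [^] Suc k) = (u \<otimes> ?a) [^] Suc k"
      using u c by (simp add: nat_pow_distrib m_ac)
    finally have "integral_quotient R (u \<otimes> ?a) ?b"
      unfolding integral_quotient_def by blast
    moreover have "?b \<noteq> \<zero>" using a b nz \<open>b \<noteq> \<zero>\<close> by (simp add: integral_iff)
    ultimately obtain d where d: "d \<in> carrier R" "u \<otimes> ?a = ?b \<otimes> d"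
      using div[of "u \<otimes> ?a" ?b] u c by auto
    \<comment> \<open>Because \<open>u t a = s b d\<close>, the quotient of \<open>x\<close> by
      \<open>y\<close> is \<open>d / u\<close>.\<close>
    have "y \<otimes>\<^bsub>M.Loc\<^esub> M.frac d u = M.frac (b \<otimes> d) (t \<otimes> u)"
      unfolding b(3) using b d u by (intro M.mult_frac) auto
    also have "\<dots> = x"
      unfolding a(3)
    proof (rule M.frac_eqI)
      show "s \<otimes> (b \<otimes> d) = t \<otimes> u \<otimes> a" using d a b u by (simp add: m_ac)
    qed (use a b d u M.mult_S in auto)
    finally show ?thesis using M.frac_in_carrier[OF d(1) u] by metis
  qed
  then show ?thesis
    unfolding normal_domain_iff localization_at_def using L.domain_axioms by auto
qed

section \<open>Associated primes\<close>

text \<open>The annihilator of the class of \<open>u\<close> in the module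
  \<open>R / J\<close>.\<close>

definition colon :: "('a, 'b) ring_scheme \<Rightarrow> 'a set \<Rightarrow> 'a \<Rightarrow> 'a set" where
  "colon R J u = {a \<in> carrier R. a \<otimes>\<^bsub>R\<^esub> u \<in> J}"

definition adjoin :: "('a, 'b) ring_scheme \<Rightarrow> 'a set \<Rightarrow> 'a \<Rightarrow> 'a set" where
  "adjoin R J x = {j \<oplus>\<^bsub>R\<^esub> r \<otimes>\<^bsub>R\<^esub> x | j r. j \<in> J \<and> r \<in> carrier R}"

text \<open>Quotient rings are replaced by ideals of the fixed ring \<open>R\<close>, so that a
  sequence of regular elements does not build a tower of quotients. That \<open>J + (x)\<close>
  stays proper is secured separately, by taking \<open>J\<close> and \<open>x\<close> inside the
  maximal ideal.\<close>

definition regular_mod :: "('a, 'b) ring_scheme \<Rightarrow> 'a set \<Rightarrow> 'a \<Rightarrow> bool" where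
  "regular_mod R J x \<longleftrightarrow>
    x \<in> carrier R \<and> (\<forall>a\<in>carrier R. x \<otimes>\<^bsub>R\<^esub> a \<in> J \<longrightarrow> a \<in> J)"

text \<open>The associated primes of the module \<open>R / J\<close>.\<close>

definition assoc_prime :: "('a, 'b) ring_scheme \<Rightarrow> 'a set \<Rightarrow> 'a set \<Rightarrow> bool" where
  "assoc_prime R J P \<longleftrightarrow> primeideal P R \<and> (\<exists>u\<in>carrier R. P = colon R J u)"

section \<open>Colon ideals and one-element extensions of ideals\<close>

context cring begin

lemma ideal_intro:
  assumes "J \<subseteq> carrier R" "\<zero> \<in> J" "\<And>a b. \<lbrakk>a \<in> J; b \<in> J\<rbrakk> \<Longrightarrow> a \<oplus> b \<in> J"
    and smult: "\<And>a r. \<lbrakk>a \<in> J; r \<in> carrier R\<rbrakk> \<Longrightarrow> r \<otimes> a \<in> J"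
  shows "ideal J R"
proof (rule idealI)
  show "subgroup J (add_monoid R)"
  proof (rule add.subgroupI)
    show "\<ominus> a \<in> J" if "a \<in> J" for a
      using smult[OF that, of "\<ominus> \<one>"] that assms(1) by (auto simp: l_minus)
  qed (use assms in auto)
  show "a \<otimes> x \<in> J" if "a \<in> J" "x \<in> carrier R" for a x
    using smult[OF that] that assms(1) m_comm by force
qed (use smult in \<open>auto intro: ring_axioms\<close>)

lemma ideal_simps:
  assumes "ideal J R"
  shows ideal_carr: "a \<in> J \<Longrightarrow> a \<in> carrier R"
    and ideal_zero: "\<zero> \<in> J"
    and ideal_add: "\<lbrakk>a \<in> J; b \<in> J\<rbrakk> \<Longrightarrow> a \<oplus> b \<in> J"
    and ideal_diff: "\<lbrakk>a \<in> J; b \<in> J\<rbrakk> \<Longrightarrow> a \<ominus> b \<in> J"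
    and ideal_smult: "\<lbrakk>a \<in> J; r \<in> carrier R\<rbrakk> \<Longrightarrow> r \<otimes> a \<in> J"
    and ideal_smult': "\<lbrakk>a \<in> J; r \<in> carrier R\<rbrakk> \<Longrightarrow> a \<otimes> r \<in> J"
proof -
  interpret ideal J R by fact
  show "a \<in> J \<Longrightarrow> a \<in> carrier R" "\<zero> \<in> J" "\<lbrakk>a \<in> J; b \<in> J\<rbrakk> \<Longrightarrow> a \<oplus> b \<in> J"
    "\<lbrakk>a \<in> J; b \<in> J\<rbrakk> \<Longrightarrow> a \<ominus> b \<in> J" "\<lbrakk>a \<in> J; r \<in> carrier R\<rbrakk> \<Longrightarrow> r \<otimes> a \<in> J"
    "\<lbrakk>a \<in> J; r \<in> carrier R\<rbrakk> \<Longrightarrow> a \<otimes> r \<in> J"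
    by (auto simp: Icarr I_l_closed I_r_closed minus_eq)
qed

lemma colon_ideal:
  assumes "ideal J R" "u \<in> carrier R"
  shows "ideal (colon R J u) R"
proof (rule ideal_intro)
  fix a b assume "a \<in> colon R J u" "b \<in> colon R J u"
  then show "a \<oplus> b \<in> colon R J u"
    using ideal_add[OF assms(1), of "a \<otimes> u" "b \<otimes> u"] assms(2) by (simp add: colon_def l_distr)
next
  fix a r assume "a \<in> colon R J u" "r \<in> carrier R"
  then show "r \<otimes> a \<in> colon R J u"
    using ideal_smult[OF assms(1), of "a \<otimes> u" r] assms(2) by (simp add: colon_def m_assoc)
qed (use assms(2) ideal_zero[OF assms(1)] in \<open>auto simp: colon_def\<close>)

lemma colon_mono:
  assumes "ideal J R" "u \<in> carrier R" "r \<in> carrier R"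
  shows "colon R J u \<subseteq> colon R J (r \<otimes> u)"
proof
  fix a assume "a \<in> colon R J u"
  then have a: "a \<in> carrier R" "a \<otimes> u \<in> J" by (auto simp: colon_def)
  have "a \<otimes> (r \<otimes> u) = r \<otimes> (a \<otimes> u)" using a assms by (simp add: m_lcomm)
  then show "a \<in> colon R J (r \<otimes> u)"
    using ideal_smult[OF assms(1) a(2) assms(3)] a by (simp add: colon_def)
qed

lemma adjoin_ideal:
  assumes "ideal J R" "x \<in> carrier R"
  shows "ideal (adjoin R J x) R"
proof (rule ideal_intro)
  note J = ideal_simps[OF assms(1)]
  show "adjoin R J x \<subseteq> carrier R" using assms J(1) by (auto simp: adjoin_def)
  have "\<zero> = \<zero> \<oplus> \<zero> \<otimes> x" using assms by simp
  then show "\<zero> \<in> adjoin R J x" using J(2) unfolding adjoin_def by blast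
  fix a assume "a \<in> adjoin R J x"
  then obtain j r where a: "a = j \<oplus> r \<otimes> x" "j \<in> J" "r \<in> carrier R" by (auto simp: adjoin_def)
  note c = a(3) J(1)[OF a(2)] assms(2)
  show "s \<otimes> a \<in> adjoin R J x" if "s \<in> carrier R" for s
  proof -
    have "s \<otimes> a = s \<otimes> j \<oplus> (s \<otimes> r) \<otimes> x" using a c that by (simp add: r_distr m_assoc)
    then show ?thesis using J(5)[OF a(2) that] a(3) that by (auto simp: adjoin_def)
  qed
  fix b assume "b \<in> adjoin R J x"
  then obtain j' r' where b: "b = j' \<oplus> r' \<otimes> x" "j' \<in> J" "r' \<in> carrier R" by (auto simp: adjoin_def)
  have "a \<oplus> b = (j \<oplus> j') \<oplus> (r \<oplus> r') \<otimes> x"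
    using a b c J(1)[OF b(2)] by (simp add: l_distr a_ac)
  then show "a \<oplus> b \<in> adjoin R J x" using J(3)[OF a(2) b(2)] a(3) b(3) unfolding adjoin_def by blast
qed

lemma adjoin_superset: "\<lbrakk>ideal J R; x \<in> carrier R\<rbrakk> \<Longrightarrow> J \<subseteq> adjoin R J x"
proof
  fix j assume J: "ideal J R" and "x \<in> carrier R" "j \<in> J"
  then have "j = j \<oplus> \<zero> \<otimes> x" using ideal_carr by simp
  then show "j \<in> adjoin R J x" using \<open>j \<in> J\<close> unfolding adjoin_def by blast
qed

lemma adjoin_self: "\<lbrakk>ideal J R; x \<in> carrier R\<rbrakk> \<Longrightarrow> x \<in> adjoin R J x"
proof -
  assume J: "ideal J R" and "x \<in> carrier R"
  then have "x = \<zero> \<oplus> \<one> \<otimes> x" by simp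
  then show "x \<in> adjoin R J x" using ideal_zero[OF J] unfolding adjoin_def by blast
qed

lemma adjoin_minimal:
  "\<lbrakk>ideal I R; J \<subseteq> I; x \<in> I\<rbrakk> \<Longrightarrow> adjoin R J x \<subseteq> I"
proof
  fix a assume I: "ideal I R" and *: "J \<subseteq> I" "x \<in> I" and "a \<in> adjoin R J x"
  then obtain j r where a: "j \<in> J" "r \<in> carrier R" "a = j \<oplus> r \<otimes> x"
    unfolding adjoin_def by blast
  then show "a \<in> I"
    using ideal_add[OF I _ ideal_smult[OF I *(2) a(2)]] *(1) by auto
qed

lemma adjoin_commute:
  assumes "ideal J R" "x \<in> carrier R" "y \<in> carrier R"
  shows "adjoin R (adjoin R J x) y = adjoin R (adjoin R J y) x"
proof -
  have "adjoin R (adjoin R J x) y \<subseteq> adjoin R (adjoin R J y) x"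
    if "x \<in> carrier R" "y \<in> carrier R" for x y
  proof -
    let ?I = "adjoin R (adjoin R J y) x"
    have Jy: "ideal (adjoin R J y) R" by (rule adjoin_ideal[OF assms(1) that(2)])
    have I: "ideal ?I R" by (rule adjoin_ideal[OF Jy that(1)])
    have "adjoin R J y \<subseteq> ?I" "x \<in> ?I"
      using adjoin_superset[OF Jy that(1)] adjoin_self[OF Jy that(1)] by auto
    moreover have "J \<subseteq> adjoin R J y" "y \<in> adjoin R J y"
      using adjoin_superset[OF assms(1) that(2)] adjoin_self[OF assms(1) that(2)] by auto
    ultimately show ?thesis by (intro adjoin_minimal I) auto
  qed
  then show ?thesis using assms by (intro equalityI)
qed

lemma regular_modD: "\<lbrakk>regular_mod R J x; a \<in> carrier R; x \<otimes> a \<in> J\<rbrakk> \<Longrightarrow> a \<in> J"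
  by (auto simp: regular_mod_def)

lemma mem_adjoinE:
  assumes "a \<in> adjoin R J x" "ideal J R" "x \<in> carrier R"
  obtains j r where "j \<in> J" "j \<in> carrier R" "r \<in> carrier R" "a = j \<oplus> x \<otimes> r"
proof -
  obtain j r where *: "j \<in> J" "r \<in> carrier R" "a = j \<oplus> r \<otimes> x"
    using assms(1) unfolding adjoin_def by blast
  show ?thesis
    using that[of j r] * ideal_carr[OF assms(2) *(1)] assms(3) by (simp add: m_comm)
qed

lemma mem_adjoinI:
  assumes "a \<in> carrier R" "x \<in> carrier R" "r \<in> carrier R" "a \<ominus> x \<otimes> r \<in> J"
  shows "a \<in> adjoin R J x"
proof -
  have "a = (a \<ominus> x \<otimes> r) \<oplus> r \<otimes> x"
    using assms by (simp add: minus_eq m_comm a_assoc l_neg)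
  then show ?thesis using assms unfolding adjoin_def by blast
qed

section \<open>Prime avoidance and prime annihilators\<close>

text \<open>Choose an element outside \<open>P\<close> from \<open>I\<close> and from each
  \<open>Q\<close>. Their product lies in all these ideals, and outside \<open>P\<close> by
  primality.\<close>

lemma avoid_prime:
  assumes "primeideal P R" "finite F" "\<And>Q. Q \<in> F \<Longrightarrow> ideal Q R \<and> \<not> Q \<subseteq> P"
    and "ideal I R" "\<not> I \<subseteq> P"
  shows "\<exists>y\<in>I. y \<notin> P \<and> (\<forall>Q\<in>F. y \<in> Q)"
  using assms(2,3)
proof (induction F rule: finite_induct)
  case empty
  then show ?case using assms(5) by auto
next
  case (insert Q F)
  then obtain y where y: "y \<in> I" "y \<notin> P" "\<forall>Q\<in>F. y \<in> Q" by auto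
  obtain w where w: "w \<in> Q" "w \<notin> P" using insert.prems by auto
  have c: "w \<in> carrier R" "y \<in> carrier R"
    using w y insert.prems assms(4) ideal_carr by blast+
  have "w \<otimes> y \<notin> P" using primeideal.I_prime[OF assms(1) c] w y by blast
  moreover have "w \<otimes> y \<in> Q" using ideal_smult' insert.prems w c by blast
  moreover have "w \<otimes> y \<in> Q'" if "Q' \<in> F" for Q' using ideal_smult insert.prems y c that by blast
  moreover have "w \<otimes> y \<in> I" using ideal_smult assms(4) y c by blast
  ultimately show ?case by blast
qed

lemma prime_avoidance:
  assumes "finite F" "\<And>P. P \<in> F \<Longrightarrow> primeideal P R \<and> \<not> I \<subseteq> P" "ideal I R"
  shows "\<exists>z\<in>I. \<forall>P\<in>F. z \<notin> P"
  using assms(1,2)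
proof (induction F rule: finite_psubset_induct)
  case (psubset F)
  show ?case
  proof (cases "F = {}")
    case True
    then show ?thesis using ideal_zero[OF assms(3)] by auto
  next
    case False
    \<comment> \<open>For a minimal \<open>P\<close> no other member of \<open>F\<close> is
      contained in \<open>P\<close>, as \<open>avoid_prime\<close> requires below.\<close>
    then obtain P where P: "P \<in> F" "\<And>Q. Q \<in> F \<Longrightarrow> Q \<subseteq> P \<Longrightarrow> Q = P"
      using finite_has_minimal[OF psubset.hyps] by auto
    have "F - {P} \<subset> F" using P by auto
    then obtain z where z: "z \<in> I" "\<forall>Q\<in>F - {P}. z \<notin> Q"
      using psubset.IH[of "F - {P}"] psubset.prems by blast
    show ?thesis
    proof (cases "z \<in> P")
      case False
      then show ?thesis using z by blast
    next
      case True
      have id: "ideal Q R" if "Q \<in> F" for Q using psubset.prems[OF that] primeideal.axioms(1) by blast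
      obtain y where y: "y \<in> I" "y \<notin> P" "\<forall>Q\<in>F - {P}. y \<in> Q"
      proof -
        have "primeideal P R" "finite (F - {P})" "\<not> I \<subseteq> P" using psubset P(1) by auto
        moreover have "ideal Q R \<and> \<not> Q \<subseteq> P" if "Q \<in> F - {P}" for Q using that P(2) id by auto
        ultimately have "\<exists>y\<in>I. y \<notin> P \<and> (\<forall>Q\<in>F - {P}. y \<in> Q)"
          using avoid_prime assms(3) by meson
        then show thesis using that by blast
      qed
      have c: "y \<in> carrier R" "z \<in> carrier R" using y z assms(3) ideal_carr by blast+
      have yz: "(z \<oplus> y) \<ominus> y = z" "(z \<oplus> y) \<ominus> z = y"
        using c by (simp_all add: diff_simps)
      \<comment> \<open>In each prime of \<open>F\<close> exactly one of the two summands lies: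
        \<open>z\<close> in \<open>P\<close>, and \<open>y\<close> in all the others. So the sum
        lies in none of them.\<close>
      have "z \<oplus> y \<notin> Q" if "Q \<in> F" for Q
      proof (cases "Q = P")
        case True
        then show ?thesis using ideal_diff[OF id[OF that], of "z \<oplus> y" z] yz y \<open>z \<in> P\<close> by auto
      next
        case False
        then show ?thesis using ideal_diff[OF id[OF that], of "z \<oplus> y" y] yz y z that by auto
      qed
      then show ?thesis using ideal_add[OF assms(3) z(1) y(1)] by blast
    qed
  qed
qed

text \<open>Maximal annihilators are prime: if \<open>a b\<close> kills \<open>w\<close> modulo
  \<open>J\<close> but \<open>b\<close> does not, then \<open>a\<close> kills \<open>b w\<close>,
  hence \<open>w\<close> by maximality. Only the multiples of \<open>w\<close> compete.\<close>

lemma primeideal_colonI: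
  assumes J: "ideal J R" and w: "w \<in> carrier R" "w \<notin> J"
    and max: "\<And>b. \<lbrakk>b \<in> carrier R; b \<otimes> w \<notin> J\<rbrakk> \<Longrightarrow> colon R J (b \<otimes> w) \<subseteq> colon R J w"
  shows "primeideal (colon R J w) R"
proof (rule primeidealI)
  show "ideal (colon R J w) R" using J w by (simp add: colon_ideal)
  have "\<one> \<notin> colon R J w" using w by (simp add: colon_def)
  then show "carrier R \<noteq> colon R J w" by auto
  fix a b assume ab: "a \<in> carrier R" "b \<in> carrier R" "a \<otimes> b \<in> colon R J w"
  then have "b \<otimes> w \<in> J \<or> a \<in> colon R J (b \<otimes> w)" using w by (auto simp: colon_def m_assoc)
  then show "a \<in> colon R J w \<or> b \<in> colon R J w"
    using max[OF ab(2)] ab(2) by (auto simp: colon_def)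
qed (rule is_cring)

end

section \<open>Consequences of the ascending chain condition\<close>

context noetherian_ring begin

text \<open>In a Noetherian ring a nonempty chain of ideals contains its union, so Zorn's lemma
  applies to any nonempty set of ideals.\<close>

lemma ideals_have_maximal:
  assumes "\<A> \<noteq> {}" "\<And>I. I \<in> \<A> \<Longrightarrow> ideal I R"
  obtains M where "M \<in> \<A>" "\<forall>I\<in>\<A>. M \<subseteq> I \<longrightarrow> I = M"
proof -
  have "\<exists>M\<in>\<A>. \<forall>I\<in>\<A>. M \<subseteq> I \<longrightarrow> I = M"
  proof (rule subset_Zorn_nonempty[OF assms(1)])
    fix C assume C: "C \<noteq> {}" "subset.chain \<A> C"
    then have "subset.chain {I. ideal I R} C"
      using assms(2) by (auto simp: pred_on.chain_def)
    then have "\<Union>C \<in> C" using ideal_chain_is_trivial[OF C(1)] by blast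
    then show "\<Union>C \<in> \<A>" using C(2) by (auto simp: pred_on.chain_def)
  qed
  then show ?thesis using that by blast
qed

text \<open>A maximal ideal among those generated by finite subsets of \<open>U\<close> absorbs
  every element of \<open>U\<close>. The point is that the generators are taken from
  \<open>U\<close> itself.\<close>

lemma finite_subset_generates:
  assumes "U \<subseteq> carrier R"
  obtains U' where "finite U'" "U' \<subseteq> U" "U \<subseteq> Idl U'"
proof -
  let ?A = "{Idl V | V. finite V \<and> V \<subseteq> U}"
  have "?A \<noteq> {}" by blast
  moreover have "ideal I R" if "I \<in> ?A" for I using that genideal_ideal assms by blast
  ultimately obtain M where M: "M \<in> ?A" "\<forall>I\<in>?A. M \<subseteq> I \<longrightarrow> I = M"
    by (rule ideals_have_maximal)
  then obtain V where V: "finite V" "V \<subseteq> U" "M = Idl V" by blast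
  have "u \<in> Idl V" if "u \<in> U" for u
  proof -
    have c: "insert u V \<subseteq> carrier R" using V that assms by auto
    have "Idl (insert u V) \<in> ?A" using V that by blast
    moreover have "M \<subseteq> Idl (insert u V)" unfolding V(3) using subset_Idl_subset[OF c] by blast
    ultimately have "Idl (insert u V) = M" using M by blast
    then show ?thesis using genideal_self[OF c] V by blast
  qed
  then show ?thesis using V that by blast
qed

end

section \<open>Existence and finiteness of associated primes\<close>

locale noetherian_cring = cring R + noetherian_ring R for R (structure)
begin

text \<open>A maximal one among the annihilators of the multiples of \<open>u\<close> that are
  nonzero modulo \<open>J\<close> is prime by \<open>primeideal_colonI\<close>.\<close>

lemma assoc_prime_above_colon:
  assumes "ideal J R" "u \<in> carrier R" "u \<notin> J"
  obtains P r where "assoc_prime R J P" "r \<in> carrier R" "P = colon R J (r \<otimes> u)" "colon R J u \<subseteq> P"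
proof -
  let ?A = "{colon R J (r \<otimes> u) | r. r \<in> carrier R \<and> r \<otimes> u \<notin> J}"
  have "colon R J (\<one> \<otimes> u) \<in> ?A" using assms(2,3) by (intro CollectI exI[of _ \<one>]) simp
  then have "?A \<noteq> {}" by blast
  moreover have "ideal I R" if "I \<in> ?A" for I using that colon_ideal assms by auto
  ultimately obtain M where M: "M \<in> ?A" "\<forall>I\<in>?A. M \<subseteq> I \<longrightarrow> I = M"
    by (rule ideals_have_maximal)
  then obtain r where r: "r \<in> carrier R" "r \<otimes> u \<notin> J" "M = colon R J (r \<otimes> u)" by blast
  have "primeideal M R" unfolding r(3)
  proof (rule primeideal_colonI[OF assms(1) _ r(2)])
    show "r \<otimes> u \<in> carrier R" using r assms by simp
    fix b assume b: "b \<in> carrier R" "b \<otimes> (r \<otimes> u) \<notin> J"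
    then have "b \<otimes> (r \<otimes> u) = (b \<otimes> r) \<otimes> u" using r assms by (simp add: m_assoc)
    then have "colon R J (b \<otimes> (r \<otimes> u)) \<in> ?A" using b r by auto
    moreover have "M \<subseteq> colon R J (b \<otimes> (r \<otimes> u))" unfolding r(3) using colon_mono assms r b by simp
    ultimately show "colon R J (b \<otimes> (r \<otimes> u)) \<subseteq> colon R J (r \<otimes> u)" using M(2) r(3) by blast
  qed
  then have "assoc_prime R J M" unfolding assoc_prime_def using r assms by auto
  moreover have "colon R J u \<subseteq> M" unfolding r(3) using colon_mono assms r by simp
  ultimately show ?thesis using that r by blast
qed

text \<open>\<open>U\<close> collects the elements whose annihilator modulo \<open>J\<close> is
  maximal among all annihilators of nonzero classes. These annihilators are primes and cover the
  zero divisors modulo \<open>J\<close>. Finitely many suffice: take a finite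
  \<open>V \<subseteq> U\<close> that generates an ideal containing \<open>U\<close>.\<close>

lemma finite_assoc_primes_cover:
  assumes J: "ideal J R"
  shows "\<exists>F. finite F \<and> (\<forall>P\<in>F. assoc_prime R J P) \<and>
    (\<forall>x\<in>carrier R. \<not> regular_mod R J x \<longrightarrow> (\<exists>P\<in>F. x \<in> P))"
proof -
  define U where "U = {w \<in> carrier R. w \<notin> J \<and>
    (\<forall>v\<in>carrier R. v \<notin> J \<longrightarrow> colon R J w \<subseteq> colon R J v \<longrightarrow> colon R J v = colon R J w)}"
  have prime: "primeideal (colon R J w) R" if "w \<in> U" for w
  proof (rule primeideal_colonI[OF J])
    fix b assume "b \<in> carrier R" "b \<otimes> w \<notin> J"
    then show "colon R J (b \<otimes> w) \<subseteq> colon R J w"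
      using that colon_mono[OF J, of w b] unfolding U_def by auto
  qed (use that in \<open>auto simp: U_def\<close>)
  have "U \<subseteq> carrier R" by (auto simp: U_def)
  then obtain V where V: "finite V" "V \<subseteq> U" "U \<subseteq> Idl V" by (rule finite_subset_generates)
  have "\<exists>v\<in>V. x \<in> colon R J v" if x: "x \<in> carrier R" "\<not> regular_mod R J x" for x
  proof -
    obtain a where a: "a \<in> carrier R" "a \<notin> J" "x \<otimes> a \<in> J"
      using x by (auto simp: regular_mod_def)
    let ?A = "{colon R J v | v. v \<in> carrier R \<and> v \<notin> J \<and> colon R J a \<subseteq> colon R J v}"
    have "?A \<noteq> {}" using a by blast
    moreover have "ideal I R" if "I \<in> ?A" for I using that colon_ideal J by auto
    ultimately obtain M where M: "M \<in> ?A" "\<forall>I\<in>?A. M \<subseteq> I \<longrightarrow> I = M"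
      by (rule ideals_have_maximal)
    then obtain w where w: "w \<in> carrier R" "w \<notin> J" "colon R J a \<subseteq> colon R J w" "M = colon R J w"
      by blast
    have wU: "w \<in> U" unfolding U_def
    proof (intro CollectI conjI ballI impI)
      fix v assume "v \<in> carrier R" "v \<notin> J" "colon R J w \<subseteq> colon R J v"
      then show "colon R J v = colon R J w" using M(2) w by blast
    qed (use w in auto)
    \<comment> \<open>Otherwise some \<open>y\<close> outside the prime \<open>colon R J w\<close>
      lies in all annihilators of elements of \<open>V\<close>. Then \<open>y\<close> kills the
      ideal generated by \<open>V\<close>, and with it \<open>w\<close>, a contradiction.\<close>
    have "\<exists>v\<in>V. colon R J v \<subseteq> colon R J w"
    proof (rule ccontr)
      assume no: "\<not> ?thesis"
      have "\<exists>y\<in>carrier R. y \<notin> colon R J w \<and> (\<forall>Q\<in>colon R J ` V. y \<in> Q)"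
      proof (rule avoid_prime[OF prime[OF wU]])
        show "\<not> carrier R \<subseteq> colon R J w" using w by (auto simp: colon_def)
        show "ideal Q R \<and> \<not> Q \<subseteq> colon R J w" if "Q \<in> colon R J ` V" for Q
          using that no V(2) colon_ideal[OF J] by (auto simp: U_def)
      qed (use V oneideal in auto)
      then obtain y where y: "y \<in> carrier R" "y \<notin> colon R J w" "\<And>v. v \<in> V \<Longrightarrow> y \<otimes> v \<in> J"
        by (auto simp: colon_def)
      have "V \<subseteq> colon R J y"
      proof
        fix v assume v: "v \<in> V"
        then have "v \<in> carrier R" using V(2) \<open>U \<subseteq> carrier R\<close> by blast
        then show "v \<in> colon R J y" using y(1) y(3)[OF v] by (simp add: colon_def m_comm)
      qed
      then have "Idl V \<subseteq> colon R J y" using genideal_minimal colon_ideal[OF J y(1)] by blast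
      then have "w \<in> colon R J y" using wU V(3) by blast
      then show False using y(1,2) w(1) by (simp add: colon_def m_comm)
    qed
    then obtain v where v: "v \<in> V" "colon R J v \<subseteq> colon R J w" by blast
    then have "colon R J w = colon R J v" using V(2) w by (auto simp: U_def)
    moreover have "x \<in> colon R J a" using a x by (simp add: colon_def)
    ultimately show ?thesis using v w(3) by blast
  qed
  moreover have "assoc_prime R J (colon R J v)" if "v \<in> V" for v
    using that V(2) prime by (auto simp: assoc_prime_def U_def)
  ultimately show ?thesis using V(1) by (intro exI[of _ "colon R J ` V"]) auto
qed

text \<open>Prime avoidance for the associated primes of two ideals at once, because the exchange
  argument needs an element regular modulo both. With both ideals equal it serves for a single
  one.\<close>

lemma regular_element_in_ideal:
  assumes "ideal J\<^sub>1 R" "ideal J\<^sub>2 R" "ideal I R"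
    and "\<And>P. assoc_prime R J\<^sub>1 P \<or> assoc_prime R J\<^sub>2 P \<Longrightarrow> \<not> I \<subseteq> P"
  shows "\<exists>z\<in>I. regular_mod R J\<^sub>1 z \<and> regular_mod R J\<^sub>2 z"
proof -
  obtain F\<^sub>1 where F1: "finite F\<^sub>1" "\<forall>P\<in>F\<^sub>1. assoc_prime R J\<^sub>1 P"
    "\<forall>x\<in>carrier R. \<not> regular_mod R J\<^sub>1 x \<longrightarrow> (\<exists>P\<in>F\<^sub>1. x \<in> P)"
    using finite_assoc_primes_cover[OF assms(1)] by auto
  obtain F\<^sub>2 where F2: "finite F\<^sub>2" "\<forall>P\<in>F\<^sub>2. assoc_prime R J\<^sub>2 P"
    "\<forall>x\<in>carrier R. \<not> regular_mod R J\<^sub>2 x \<longrightarrow> (\<exists>P\<in>F\<^sub>2. x \<in> P)"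
    using finite_assoc_primes_cover[OF assms(2)] by auto
  have "\<exists>z\<in>I. \<forall>P\<in>F\<^sub>1 \<union> F\<^sub>2. z \<notin> P"
  proof (rule prime_avoidance[OF _ _ assms(3)])
    show "primeideal P R \<and> \<not> I \<subseteq> P" if "P \<in> F\<^sub>1 \<union> F\<^sub>2" for P
      using that F1(2) F2(2) assms(4) by (auto simp: assoc_prime_def)
  qed (use F1 F2 in simp)
  then obtain z where "z \<in> I" "\<forall>P\<in>F\<^sub>1 \<union> F\<^sub>2. z \<notin> P" by blast
  then show ?thesis using F1(3) F2(3) ideal_carr[OF assms(3)] by blast
qed

end

section \<open>Regular sequences in Noetherian local rings\<close>

locale noetherian_local_ring = noetherian_cring R + local_ring R for R (structure) +
  fixes m assumes maximal: "maximalideal m R"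
begin

lemma m_ideal: "ideal m R"
  using maximal by (rule maximalideal.axioms)

lemma one_notin_m: "\<one> \<notin> m"
  using ideal.one_imp_carrier[OF m_ideal] maximalideal.I_notcarr[OF maximal] by metis

lemma m_carr: "x \<in> m \<Longrightarrow> x \<in> carrier R"
  by (rule ideal_carr[OF m_ideal])

lemma proper_ideal_le_m:
  assumes "ideal J R" "\<one> \<notin> J"
  shows "J \<subseteq> m"
proof -
  let ?A = "{I. ideal I R \<and> J \<subseteq> I \<and> \<one> \<notin> I}"
  have "?A \<noteq> {}" using assms by blast
  moreover have "\<And>I. I \<in> ?A \<Longrightarrow> ideal I R" by blast
  ultimately obtain M where M: "M \<in> ?A" "\<forall>I\<in>?A. M \<subseteq> I \<longrightarrow> I = M"
    by (rule ideals_have_maximal)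
  have "maximalideal M R"
  proof (rule maximalidealI)
    show "carrier R \<noteq> M" using M(1) by auto
    show "I = M \<or> I = carrier R" if "ideal I R" "M \<subseteq> I" "I \<subseteq> carrier R" for I
      using M that ideal.one_imp_carrier[OF that(1)] by blast
  qed (use M in blast)
  then show ?thesis using M(1) unique_maximal maximal by blast
qed

lemma unit_if_notin_m:
  assumes "x \<in> carrier R" "x \<notin> m"
  obtains y where "y \<in> carrier R" "y \<otimes> x = \<one>"
proof -
  have I: "ideal (PIdl x) R" "x \<in> PIdl x" using assms by (simp_all add: cgenideal_ideal cgenideal_self)
  then have "\<one> \<in> PIdl x" using proper_ideal_le_m assms(2) by blast
  then obtain y where "y \<in> carrier R" "\<one> = y \<otimes> x" unfolding cgenideal_def by blast
  then show ?thesis using that by simp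
qed

text \<open>The factor \<open>\<one> \<ominus> x \<otimes> r\<close> is a unit, since
  \<open>x\<close> lies in the maximal ideal.\<close>

lemma mem_if_one_minus_mult_mem:
  assumes "ideal J R" "x \<in> m" "r \<in> carrier R" "a \<in> carrier R" "a \<ominus> x \<otimes> r \<otimes> a \<in> J"
  shows "a \<in> J"
proof -
  note c = m_carr[OF assms(2)] assms(3,4)
  have xr: "x \<otimes> r \<in> m" using ideal_smult'[OF m_ideal assms(2,3)] .
  have "\<one> \<ominus> x \<otimes> r \<notin> m"
  proof
    assume "\<one> \<ominus> x \<otimes> r \<in> m"
    then have "(\<one> \<ominus> x \<otimes> r) \<oplus> x \<otimes> r \<in> m" using ideal_add[OF m_ideal] xr by blast
    also have "(\<one> \<ominus> x \<otimes> r) \<oplus> x \<otimes> r = \<one>"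
      using c by (simp add: diff_simps)
    finally show False using one_notin_m by simp
  qed
  then obtain y where y: "y \<in> carrier R" "y \<otimes> (\<one> \<ominus> x \<otimes> r) = \<one>"
    using unit_if_notin_m[of "\<one> \<ominus> x \<otimes> r"] c by auto
  have "y \<otimes> (a \<ominus> x \<otimes> r \<otimes> a) = (y \<otimes> (\<one> \<ominus> x \<otimes> r)) \<otimes> a"
    using c y(1) by (simp add: diff_simps)
  also have "\<dots> = a" using y c by simp
  finally show ?thesis using ideal_smult[OF assms(1,5) y(1)] by simp
qed

text \<open>A form of Nakayama's lemma: among the ideals \<open>J + (a)\<close> with \<open>a \<in> K - J\<close> a maximal one, when
  \<open>a = j + x b\<close>, also contains \<open>b\<close>, so that \<open>(1 - x r) a \<in> J\<close>.\<close>

lemma subset_if_subset_add_mult: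
  assumes J: "ideal J R" and x: "x \<in> m" and K: "K \<subseteq> carrier R"
    and step: "\<And>a. a \<in> K \<Longrightarrow> \<exists>j\<in>J. \<exists>b\<in>K. a = j \<oplus> x \<otimes> b"
  shows "K \<subseteq> J"
proof (rule ccontr)
  assume "\<not> K \<subseteq> J"
  let ?A = "{adjoin R J a | a. a \<in> K \<and> a \<notin> J}"
  have "?A \<noteq> {}" using \<open>\<not> K \<subseteq> J\<close> by blast
  moreover have "\<And>I. I \<in> ?A \<Longrightarrow> ideal I R" using adjoin_ideal[OF J] K by blast
  ultimately obtain M where M: "M \<in> ?A" "\<forall>I\<in>?A. M \<subseteq> I \<longrightarrow> I = M"
    by (rule ideals_have_maximal)
  then obtain a where a: "a \<in> K" "a \<notin> J" "M = adjoin R J a" by blast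
  obtain j b where b: "j \<in> J" "b \<in> K" "a = j \<oplus> x \<otimes> b" using step[OF a(1)] by blast
  have c: "a \<in> carrier R" "b \<in> carrier R" "x \<in> carrier R" "j \<in> carrier R"
    using a b K m_carr[OF x] ideal_carr[OF J] by auto
  have "b \<notin> J" using a(2) b(1) ideal_add[OF J b(1) ideal_smult[OF J _ c(3), of b]] b(3) by blast
  have Jb: "ideal (adjoin R J b) R" "J \<subseteq> adjoin R J b" "b \<in> adjoin R J b"
    using adjoin_ideal[OF J c(2)] adjoin_superset[OF J c(2)] adjoin_self[OF J c(2)] .
  have "a \<in> adjoin R J b"
    unfolding b(3) using b(1) Jb(2) ideal_add[OF Jb(1) _ ideal_smult[OF Jb(1,3) c(3)]] by blast
  then have "M \<subseteq> adjoin R J b" unfolding a(3) using adjoin_minimal[OF Jb(1,2)] by blast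
  then have "b \<in> adjoin R J a" using M(2) Jb(3) a(3) b(2) \<open>b \<notin> J\<close> by blast
  then obtain j' r where r: "j' \<in> J" "j' \<in> carrier R" "r \<in> carrier R" "b = j' \<oplus> a \<otimes> r"
    using mem_adjoinE[OF _ J c(1)] by blast
  have "a \<ominus> x \<otimes> r \<otimes> a = (j \<oplus> x \<otimes> b) \<ominus> x \<otimes> r \<otimes> a" using b(3) by simp
  also have "\<dots> = j \<oplus> x \<otimes> j'"
    unfolding r(4) using c r(2,3) by (simp add: diff_simps)
  finally have "a \<ominus> x \<otimes> r \<otimes> a \<in> J"
    using ideal_add[OF J b(1) ideal_smult[OF J r(1) c(3)]] by simp
  then show False using mem_if_one_minus_mult_mem[OF J x r(3) c(1)] a(2) by blast
qed

section \<open>Exchange of regular elements and depth\<close>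

text \<open>With \<open>M = R / J\<close> and \<open>k = R / m\<close>, this is an elementary form
  of the isomorphisms between \<open>Hom(k, M/xM)\<close>, \<open>Ext^1(k, M)\<close> and
  \<open>Hom(k, M/yM)\<close>. If \<open>m\<close> kills \<open>u\<close> modulo
  \<open>J + (x)\<close>, write \<open>y u\<close> and \<open>w u\<close> as \<open>x v\<close> and
  \<open>x t\<close> modulo \<open>J\<close>. Eliminating \<open>u\<close> gives
  \<open>w v = y t\<close> modulo \<open>J\<close>, so regularity of \<open>w\<close> puts
  \<open>v\<close> into \<open>J + (y)\<close>. Cancelling \<open>y\<close> then puts
  \<open>u\<close> into \<open>J + (x)\<close>.\<close>

lemma assoc_prime_adjoin_not_m:
  assumes J: "ideal J R" and x: "x \<in> m" "regular_mod R J x" and y: "y \<in> m" "regular_mod R J y"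
    and w: "w \<in> m" "regular_mod R (adjoin R J y) w" and P: "assoc_prime R (adjoin R J x) P"
  shows "\<not> m \<subseteq> P"
proof
  assume mP: "m \<subseteq> P"
  obtain u where u: "u \<in> carrier R" "P = colon R (adjoin R J x) u"
    using P by (auto simp: assoc_prime_def)
  note c = m_carr[OF x(1)] m_carr[OF y(1)] m_carr[OF w(1)] u(1)
  have PI: "primeideal P R" using P by (simp add: assoc_prime_def)
  have uJ: "u \<notin> adjoin R J x"
  proof
    assume "u \<in> adjoin R J x"
    then have "carrier R = P"
      unfolding u(2) colon_def using ideal_smult[OF adjoin_ideal[OF J c(1)]] by blast
    then show False using primeideal.I_notcarr[OF PI] by simp
  qed
  have "y \<otimes> u \<in> adjoin R J x" using mP y(1) u(2) by (auto simp: colon_def)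
  then obtain j0 v where v: "j0 \<in> J" "j0 \<in> carrier R" "v \<in> carrier R" "y \<otimes> u = j0 \<oplus> x \<otimes> v"
    using mem_adjoinE[OF _ J c(1)] by blast
  have "w \<otimes> u \<in> adjoin R J x" using mP w(1) u(2) by (auto simp: colon_def)
  then obtain j1 t where t: "j1 \<in> J" "j1 \<in> carrier R" "t \<in> carrier R" "w \<otimes> u = j1 \<oplus> x \<otimes> t"
    using mem_adjoinE[OF _ J c(1)] by blast
  note c2 = c v(2,3) t(2,3)
  have "x \<otimes> (w \<otimes> v \<ominus> y \<otimes> t) =
      w \<otimes> (j0 \<oplus> x \<otimes> v) \<ominus> y \<otimes> (j1 \<oplus> x \<otimes> t) \<oplus> (y \<otimes> j1 \<ominus> w \<otimes> j0)"
    using c2 by (simp add: diff_simps)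
  also have "\<dots> = y \<otimes> j1 \<ominus> w \<otimes> j0"
    unfolding v(4)[symmetric] t(4)[symmetric]
    using c2 by (simp add: diff_simps)
  finally have "x \<otimes> (w \<otimes> v \<ominus> y \<otimes> t) \<in> J"
    using ideal_diff[OF J ideal_smult[OF J t(1) c(2)] ideal_smult[OF J v(1) c(3)]] by simp
  then have "w \<otimes> v \<ominus> y \<otimes> t \<in> J" using regular_modD[OF x(2)] c2 by auto
  then have "w \<otimes> v \<in> adjoin R J y" using mem_adjoinI[of "w \<otimes> v" y t J] c2 by auto
  then have "v \<in> adjoin R J y" using regular_modD[OF w(2)] v by blast
  then obtain j t' where t': "j \<in> J" "j \<in> carrier R" "t' \<in> carrier R" "v = j \<oplus> y \<otimes> t'"
    using mem_adjoinE[OF _ J c(2)] by blast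
  note c3 = c2 t'(2,3)
  have "y \<otimes> (u \<ominus> x \<otimes> t') = y \<otimes> u \<ominus> x \<otimes> y \<otimes> t'"
    using c3 by (simp add: diff_simps)
  also have "\<dots> = j0 \<oplus> x \<otimes> (j \<oplus> y \<otimes> t') \<ominus> x \<otimes> y \<otimes> t'" using v(4) t'(4) by simp
  also have "\<dots> = j0 \<oplus> x \<otimes> j"
    using c3 by (simp add: diff_simps)
  finally have "y \<otimes> (u \<ominus> x \<otimes> t') \<in> J"
    using ideal_add[OF J v(1) ideal_smult[OF J t'(1) c(1)]] by simp
  then have "u \<ominus> x \<otimes> t' \<in> J" using regular_modD[OF y(2)] c3 by auto
  then have "u \<in> adjoin R J x" using mem_adjoinI[of u x t' J] c3 by auto
  then show False using uJ by simp
qed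

text \<open>Regular sequences of length two in a local ring can be permuted. If \<open>z\<close>
  kills \<open>a\<close> modulo \<open>J\<close>, then \<open>a = j + y b\<close> where
  \<open>z\<close> again kills \<open>b\<close>, so \<open>subset_if_subset_add_mult\<close> applies
  to the set of such \<open>a\<close>. The second claim cancels \<open>z\<close> modulo
  \<open>J + (y)\<close> and then \<open>y\<close> modulo \<open>J\<close>.\<close>

lemma regular_swap:
  assumes J: "ideal J R" and y: "y \<in> m" "regular_mod R J y"
    and z: "z \<in> m" "regular_mod R (adjoin R J y) z"
  shows "regular_mod R J z" "regular_mod R (adjoin R J z) y"
proof -
  note c = m_carr[OF y(1)] m_carr[OF z(1)]
  have "{a \<in> carrier R. z \<otimes> a \<in> J} \<subseteq> J"
  proof (rule subset_if_subset_add_mult[OF J y(1)])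
    fix a assume "a \<in> {a \<in> carrier R. z \<otimes> a \<in> J}"
    then have a: "a \<in> carrier R" "z \<otimes> a \<in> J" by auto
    have "z \<otimes> a \<in> adjoin R J y" using a adjoin_superset[OF J c(1)] by blast
    then have "a \<in> adjoin R J y" using regular_modD[OF z(2) a(1)] by simp
    then obtain j b where b: "j \<in> J" "j \<in> carrier R" "b \<in> carrier R" "a = j \<oplus> y \<otimes> b"
      using mem_adjoinE[OF _ J c(1)] by blast
    have "y \<otimes> (z \<otimes> b) = z \<otimes> (j \<oplus> y \<otimes> b) \<ominus> z \<otimes> j"
      using c b(2,3) by (simp add: diff_simps)
    then have "y \<otimes> (z \<otimes> b) \<in> J"
      using ideal_diff[OF J a(2) ideal_smult[OF J b(1) c(2)]] b(4) by simp
    then have "z \<otimes> b \<in> J" using regular_modD[OF y(2)] c b by simp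
    then show "\<exists>j\<in>J. \<exists>b\<in>{a \<in> carrier R. z \<otimes> a \<in> J}. a = j \<oplus> y \<otimes> b" using b by blast
  qed auto
  then show "regular_mod R J z" using c by (auto simp: regular_mod_def)
  show "regular_mod R (adjoin R J z) y" unfolding regular_mod_def
  proof (intro conjI ballI impI c)
    fix a assume a: "a \<in> carrier R" "y \<otimes> a \<in> adjoin R J z"
    then obtain j n where n: "j \<in> J" "j \<in> carrier R" "n \<in> carrier R" "y \<otimes> a = j \<oplus> z \<otimes> n"
      using mem_adjoinE[OF _ J c(2)] by blast
    have "z \<otimes> n \<ominus> y \<otimes> a = z \<otimes> n \<ominus> (j \<oplus> z \<otimes> n)" using n(4) by simp
    also have "\<dots> = \<zero> \<ominus> j"
      using c n(2,3) by (simp add: diff_simps)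
    finally have "z \<otimes> n \<ominus> y \<otimes> a \<in> J"
      using ideal_diff[OF J ideal_zero[OF J] n(1)] by simp
    then have "z \<otimes> n \<in> adjoin R J y" using mem_adjoinI[of "z \<otimes> n" y a J] c n a by simp
    then have "n \<in> adjoin R J y" using regular_modD[OF z(2) n(3)] by simp
    then obtain j' n' where n': "j' \<in> J" "j' \<in> carrier R" "n' \<in> carrier R" "n = j' \<oplus> y \<otimes> n'"
      using mem_adjoinE[OF _ J c(1)] by blast
    note c2 = c a(1) n(2) n'(2,3)
    have "y \<otimes> (a \<ominus> z \<otimes> n') = y \<otimes> a \<ominus> z \<otimes> y \<otimes> n'"
      using c2 by (simp add: diff_simps)
    also have "\<dots> = j \<oplus> z \<otimes> (j' \<oplus> y \<otimes> n') \<ominus> z \<otimes> y \<otimes> n'" using n(4) n'(4) by simp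
    also have "\<dots> = j \<oplus> z \<otimes> j'"
      using c2 by (simp add: diff_simps)
    finally have "y \<otimes> (a \<ominus> z \<otimes> n') \<in> J"
      using ideal_add[OF J n(1) ideal_smult[OF J n'(1) c(2)]] by simp
    then have "a \<ominus> z \<otimes> n' \<in> J" using regular_modD[OF y(2)] c2 by simp
    then show "a \<in> adjoin R J z" using mem_adjoinI[of a z n' J] c2 by simp
  qed
qed

text \<open>Existence of a regular sequence of length \<open>n\<close> modulo \<open>J\<close> in
  \<open>m\<close>, as a recursion on its first element; the ideal absorbs the elements already
  chosen. This form suits the replacement of the first element.\<close>

primrec depth_ge :: "nat \<Rightarrow> 'a set \<Rightarrow> bool" where
  "depth_ge 0 J \<longleftrightarrow> ideal J R \<and> J \<subseteq> m"
| "depth_ge (Suc n) J \<longleftrightarrow> ideal J R \<and> J \<subseteq> m \<and>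
    (\<exists>x\<in>m. regular_mod R J x \<and> depth_ge n (adjoin R J x))"

lemma depth_ge_ideal: "depth_ge n J \<Longrightarrow> ideal J R \<and> J \<subseteq> m"
  by (cases n) auto

lemma adjoin_le_m: "\<lbrakk>J \<subseteq> m; x \<in> m\<rbrakk> \<Longrightarrow> adjoin R J x \<subseteq> m"
  by (rule adjoin_minimal[OF m_ideal])

text \<open>The exchange passes from \<open>y\<close> to \<open>x\<close> through an element \<open>z\<close> that is regular modulo both
  \<open>J + (x)\<close> and \<open>J + (y)\<close>: the sequence starts with \<open>y, z\<close>, then \<open>z, y\<close>, then \<open>z, x\<close>, then
  \<open>x, z\<close>.\<close>

lemma depth_ge_adjoin:
  assumes "depth_ge (Suc n) J" "x \<in> m" "regular_mod R J x"
  shows "depth_ge n (adjoin R J x)"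
  using assms
proof (induction n arbitrary: J x)
  case 0
  then show ?case using adjoin_ideal m_carr adjoin_le_m by simp
next
  case (Suc n)
  note x = Suc.prems(2,3)
  have J: "ideal J R" "J \<subseteq> m" using Suc.prems(1) by auto
  obtain y where y: "y \<in> m" "regular_mod R J y" "depth_ge (Suc n) (adjoin R J y)"
    using Suc.prems(1) by auto
  obtain w where w: "w \<in> m" "regular_mod R (adjoin R J y) w" using y(3) by auto
  have Ix: "ideal (adjoin R J x) R" and Iy: "ideal (adjoin R J y) R"
    using adjoin_ideal[OF J(1)] m_carr x(1) y(1) by auto
  \<comment> \<open>By \<open>assoc_prime_adjoin_not_m\<close>, once for \<open>x\<close> and once
    with \<open>y\<close> in both roles, no associated prime of either ideal contains
    \<open>m\<close>.\<close>
  have "\<exists>z\<in>m. regular_mod R (adjoin R J x) z \<and> regular_mod R (adjoin R J y) z"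
  proof (rule regular_element_in_ideal[OF Ix Iy m_ideal])
    fix P assume "assoc_prime R (adjoin R J x) P \<or> assoc_prime R (adjoin R J y) P"
    then show "\<not> m \<subseteq> P"
      using assoc_prime_adjoin_not_m[OF J(1) x y(1,2) w] assoc_prime_adjoin_not_m[OF J(1) y(1,2) y(1,2) w]
      by blast
  qed
  then obtain z where z: "z \<in> m" "regular_mod R (adjoin R J x) z" "regular_mod R (adjoin R J y) z"
    by blast
  have yz: "regular_mod R J z" "regular_mod R (adjoin R J z) y"
    using regular_swap[OF J(1) y(1,2) z(1,3)] .
  have xz: "regular_mod R (adjoin R J z) x" using regular_swap(2)[OF J(1) x z(1,2)] .
  have "depth_ge n (adjoin R (adjoin R J y) z)" using Suc.IH[OF y(3) z(1,3)] .
  then have "depth_ge n (adjoin R (adjoin R J z) y)"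
    using adjoin_commute[OF J(1)] m_carr y(1) z(1) by simp
  then have "depth_ge (Suc n) (adjoin R J z)"
    using yz(2) y(1) adjoin_ideal[OF J(1) m_carr[OF z(1)]] adjoin_le_m[OF J(2) z(1)] by auto
  then have "depth_ge n (adjoin R (adjoin R J z) x)" using Suc.IH xz x(1) by blast
  then have "depth_ge n (adjoin R (adjoin R J x) z)"
    using adjoin_commute[OF J(1)] m_carr x(1) z(1) by simp
  then show ?case using z(1,2) Ix adjoin_le_m[OF J(2) x(1)] by auto
qed

text \<open>Otherwise take \<open>M\<close> maximal among the ideals of infinite depth. Adjoining a
  regular \<open>x\<close> keeps the depth infinite, so \<open>x \<in> M\<close>, and regularity of
  \<open>x\<close> then gives \<open>\<one> \<in> M\<close>.\<close>

lemma depth_finite: "\<exists>n. \<not> depth_ge n J"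
proof (rule ccontr)
  assume *: "\<not> ?thesis"
  let ?A = "{J. \<forall>n. depth_ge n J}"
  have "?A \<noteq> {}" using * by blast
  moreover have "\<And>I. I \<in> ?A \<Longrightarrow> ideal I R" using depth_ge_ideal by blast
  ultimately obtain M where M: "M \<in> ?A" "\<forall>I\<in>?A. M \<subseteq> I \<longrightarrow> I = M"
    by (rule ideals_have_maximal)
  then have ge: "depth_ge n M" for n by blast
  then obtain x where x: "x \<in> m" "regular_mod R M x" using depth_ge.simps(2)[of 0 M] by blast
  have I: "ideal M R" "M \<subseteq> m" using depth_ge_ideal ge by auto
  have "adjoin R M x \<in> ?A" using depth_ge_adjoin[OF ge x] by blast
  then have "adjoin R M x = M" using M(2) adjoin_superset[OF I(1) m_carr[OF x(1)]] by blast
  then have "x \<in> M" using adjoin_self[OF I(1) m_carr[OF x(1)]] by simp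
  then have "\<one> \<in> M" using regular_modD[OF x(2), of \<one>] m_carr[OF x(1)] by simp
  then show False using I(2) one_notin_m by blast
qed

lemma depth_ge_Suc_imp: "depth_ge (Suc n) J \<Longrightarrow> depth_ge n J"
  by (induction n arbitrary: J) auto

lemma depth_ge_mono: "\<lbrakk>depth_ge n J; k \<le> n\<rbrakk> \<Longrightarrow> depth_ge k J"
proof (induction n)
  case (Suc n)
  then show ?case using depth_ge_Suc_imp[of n J] by (cases "k = Suc n") (simp_all del: depth_ge.simps)
qed simp

text \<open>If \<open>x\<close> is regular modulo \<open>J\<close>, then the elements killed by \<open>P\<close> modulo \<open>J\<close> are not all in
  \<open>J + (x)\<close>, so some associated prime of \<open>J + (x)\<close> contains \<open>P + (x)\<close>.\<close>

lemma assoc_prime_chain: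
  assumes "depth_ge n J" "assoc_prime R J P"
  shows "\<exists>C. prime_chain R n C \<and> C 0 = P"
  using assms
proof (induction n arbitrary: J P)
  case 0
  then show ?case by (intro exI[of _ "\<lambda>_. P"]) (auto simp: prime_chain_def assoc_prime_def)
next
  case (Suc n)
  obtain x where x: "x \<in> m" "regular_mod R J x" "depth_ge n (adjoin R J x)"
    using Suc.prems(1) by auto
  have J: "ideal J R" using Suc.prems(1) by simp
  note xR = m_carr[OF x(1)]
  obtain u where u: "u \<in> carrier R" "P = colon R J u" using Suc.prems(2) by (auto simp: assoc_prime_def)
  have P: "primeideal P R" using Suc.prems(2) by (simp add: assoc_prime_def)
  have uJ: "u \<notin> J"
    using u ideal_smult[OF J] primeideal.I_notcarr[OF P] by (auto simp: colon_def)
  let ?K = "{a \<in> carrier R. \<forall>p\<in>P. p \<otimes> a \<in> J}"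
  have PR: "P \<subseteq> carrier R" unfolding u(2) by (auto simp: colon_def)
  have "u \<in> ?K" using u by (auto simp: colon_def)
  then have "\<not> ?K \<subseteq> J" using uJ by blast
  \<comment> \<open>If every element of \<open>?K\<close> were \<open>j + x b\<close> with
    \<open>b\<close> again in \<open>?K\<close>, Nakayama would give
    \<open>?K \<subseteq> J\<close>. Division by \<open>x\<close> stays inside \<open>?K\<close>, so
    this \<open>a\<close> lies outside \<open>J + (x)\<close>.\<close>
  then obtain a where a: "a \<in> ?K" "\<not> (\<exists>j\<in>J. \<exists>b\<in>?K. a = j \<oplus> x \<otimes> b)"
    using subset_if_subset_add_mult[OF J x(1), of ?K] by blast
  have aR: "a \<in> carrier R" using a by simp
  have "a \<notin> adjoin R J x"
  proof
    assume "a \<in> adjoin R J x"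
    then obtain j b where b: "j \<in> J" "j \<in> carrier R" "b \<in> carrier R" "a = j \<oplus> x \<otimes> b"
      using mem_adjoinE[OF _ J xR] by blast
    have "p \<otimes> b \<in> J" if "p \<in> P" for p
    proof -
      have pR: "p \<in> carrier R" using that PR by blast
      have "x \<otimes> (p \<otimes> b) = p \<otimes> (j \<oplus> x \<otimes> b) \<ominus> p \<otimes> j"
        using xR pR b(2,3) by (simp add: diff_simps)
      moreover have "p \<otimes> (j \<oplus> x \<otimes> b) \<in> J" using a(1) that b(4) by blast
      ultimately have "x \<otimes> (p \<otimes> b) \<in> J"
        using ideal_diff[OF J _ ideal_smult[OF J b(1) pR]] by simp
      then show ?thesis using regular_modD[OF x(2)] pR b(3) by simp
    qed
    then show False using a(2) b by blast
  qed
  then obtain Q where Q: "assoc_prime R (adjoin R J x) Q" "colon R (adjoin R J x) a \<subseteq> Q"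
    using assoc_prime_above_colon[OF adjoin_ideal[OF J xR] aR] by metis
  have sup: "J \<subseteq> adjoin R J x" "x \<in> adjoin R J x"
    using adjoin_superset[OF J xR] adjoin_self[OF J xR] .
  have "P \<subseteq> Q"
    using Q(2) a(1) PR sup(1) by (auto simp: colon_def)
  moreover have "x \<in> Q"
    using Q(2) sup(2) xR ideal_smult'[OF adjoin_ideal[OF J xR] sup(2) aR] by (auto simp: colon_def)
  \<comment> \<open>Regularity of \<open>x\<close> keeps it out of the annihilator of
    \<open>u\<close>, so the inclusion of \<open>P\<close> in \<open>Q\<close> is strict.\<close>
  moreover have "x \<notin> P"
    using uJ regular_modD[OF x(2) u(1)] unfolding u(2) by (auto simp: colon_def)
  ultimately have PQ: "P \<subset> Q" by blast
  obtain C where C: "prime_chain R n C" "C 0 = Q" using Suc.IH[OF x(3) Q(1)] by blast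
  have "prime_chain R (Suc n) (case_nat P C)"
    using C P PQ unfolding prime_chain_def by (auto split: nat.split)
  then show ?case by (intro exI[of _ "case_nat P C"]) simp
qed

end

section \<open>From regular sequences in quotient rings to depth by ideals\<close>

lemma (in cring) regular_mod_if_nonzerodivisor_Quot:
  assumes "ideal J R" "x \<in> carrier R" "nonzerodivisor (R Quot J) (J +> x)"
  shows "regular_mod R J x"
  unfolding regular_mod_def
proof (intro conjI ballI impI assms(2))
  interpret J: ideal J R by fact
  fix a assume a: "a \<in> carrier R" "x \<otimes> a \<in> J"
  have "(J +> x) \<otimes>\<^bsub>R Quot J\<^esub> (J +> a) = J +> (x \<otimes> a)"
    using J.rcoset_mult_add assms(2) a(1) by (simp add: FactRing_def)
  also have "\<dots> = \<zero>\<^bsub>R Quot J\<^esub>" using a_rcos_zero[OF assms(1) a(2)] by (simp add: FactRing_def)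
  finally have "J +> a = \<zero>\<^bsub>R Quot J\<^esub>"
    using assms(3) a_rcosetsI[OF J.a_subset a(1)]
    by (simp add: nonzerodivisor_def FactRing_def)
  then show "a \<in> J" using J.rcos_const_imp_mem[OF a(1)] by (simp add: FactRing_def)
qed

lemma (in cring) Idl_insert:
  assumes "x \<in> carrier R" "S \<subseteq> carrier R"
  shows "Idl (insert x S) = adjoin R (Idl S) x"
proof
  have I: "ideal (Idl S) R" and I': "ideal (Idl (insert x S)) R"
    using assms by (auto intro: genideal_ideal)
  have *: "S \<subseteq> Idl S" "insert x S \<subseteq> Idl (insert x S)"
    using genideal_self[of S] genideal_self[of "insert x S"] assms by blast+
  show "Idl (insert x S) \<subseteq> adjoin R (Idl S) x"
    using adjoin_superset[OF I assms(1)] adjoin_self[OF I assms(1)] *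
    by (intro genideal_minimal adjoin_ideal[OF I assms(1)]) auto
  show "adjoin R (Idl S) x \<subseteq> Idl (insert x S)"
    using * genideal_minimal[OF I'] by (intro adjoin_minimal[OF I']) auto
qed

lemma (in cring) Idl_empty: "Idl {} = {\<zero>}"
  using genideal_minimal[OF zeroideal, of "{}"] ideal_zero[OF genideal_ideal[of "{}"]] by auto

context noetherian_local_ring begin

text \<open>The induction runs downwards from the whole sequence: modulo the first \<open>i\<close>
  entries, the remaining ones form a regular sequence.\<close>

lemma regular_sequence_depth_ge:
  assumes "regular_sequence R xs" "set xs \<subseteq> m"
  shows "depth_ge (length xs) {\<zero>}"
proof -
  have xs: "set xs \<subseteq> carrier R" using m_carr assms(2) by blast
  have "depth_ge (length xs - i) (Idl (set (take i xs)))" if "i \<le> length xs" for i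
    using that
  proof (induction i rule: inc_induct)
    case base
    have "Idl (set xs) \<subseteq> m" by (rule genideal_minimal[OF m_ideal assms(2)])
    then show ?case using genideal_ideal[OF xs] by simp
  next
    case (step i)
    let ?J = "Idl (set (take i xs))"
    have s: "set (take i xs) \<subseteq> m" "set (take i xs) \<subseteq> carrier R"
      using set_take_subset[of i xs] assms(2) xs by auto
    have x: "xs ! i \<in> m" "xs ! i \<in> carrier R" using step(2) assms(2) xs by auto
    have J: "ideal ?J R" by (rule genideal_ideal[OF s(2)])
    have "?J \<subseteq> m" by (rule genideal_minimal[OF m_ideal s(1)])
    moreover have "regular_mod R ?J (xs ! i)"
      using assms(1) step(2) by (intro regular_mod_if_nonzerodivisor_Quot J x)
        (auto simp: regular_sequence_def)
    moreover have "depth_ge (length xs - Suc i) (adjoin R ?J (xs ! i))"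
      using step(3) step(2) Idl_insert[OF x(2) s(2)] by (simp add: take_Suc_conv_app_nth)
    moreover have "length xs - i = Suc (length xs - Suc i)" using step(2) by simp
    ultimately show ?case using J x(1) by auto
  qed
  from this[of 0] show ?thesis by (simp add: Idl_empty)
qed

text \<open>The lengths of regular sequences are bounded by \<open>depth_finite\<close>, and the
  empty sequence is one of them, so the supremum is a maximum.\<close>

lemma depth_attained: "\<exists>n. depth R m = enat n \<and> depth_ge n {\<zero>}"
proof -
  let ?L = "{enat (length xs) | xs. regular_sequence R xs \<and> set xs \<subseteq> m}"
  obtain N where N: "\<not> depth_ge N {\<zero>}" using depth_finite by blast
  have "length xs < N" if "regular_sequence R xs" "set xs \<subseteq> m" for xs
    using regular_sequence_depth_ge[OF that] depth_ge_mono N by (meson not_le)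
  then have "?L \<subseteq> enat ` {..<N}" by auto
  then have fin: "finite ?L" by (rule finite_subset) simp
  have "\<one> \<notin> {\<zero>}" using one_notin_m ideal_zero[OF m_ideal] by auto
  then have "{\<zero>} \<noteq> carrier R" using one_closed by metis
  then have "regular_sequence R []" by (simp add: regular_sequence_def Idl_empty)
  then have "enat (length []) \<in> ?L" by fastforce
  then have "depth R m \<in> ?L"
    using fin Max_in[OF fin] unfolding depth_def Sup_enat_def by (auto split: if_splits)
  then show ?thesis using regular_sequence_depth_ge by auto
qed

end

section \<open>Prime chains, height and dimension\<close>

lemma prime_chain_append:
  assumes "prime_chain R j B" "prime_chain R k C" "B j = C 0"
  shows "prime_chain R (j + k) (\<lambda>i. if i \<le> j then B i else C (i - j))"
  unfolding prime_chain_def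
proof (intro conjI allI impI)
  fix i assume "i \<le> j + k"
  then show "primeideal (if i \<le> j then B i else C (i - j)) R"
    using assms by (auto simp: prime_chain_def)
next
  fix i assume i: "i < j + k"
  consider "i < j" | "i = j" | "i > j" by linarith
  then show "(if i \<le> j then B i else C (i - j)) \<subset> (if Suc i \<le> j then B (Suc i) else C (Suc i - j))"
  proof cases
    case 1
    then show ?thesis using assms(1) by (auto simp: prime_chain_def)
  next
    case 2
    then show ?thesis using assms i by (auto simp: prime_chain_def)
  next
    case 3
    then show ?thesis using assms(2) i by (auto simp: prime_chain_def Suc_diff_le)
  qed
qed

text \<open>A chain of length \<open>n\<close> that ends in \<open>p\<close>, continued by the chain
  of length \<open>k\<close> above \<open>p\<close>, gives
  \<open>n + k \<le> d \<le> k + h\<close>.\<close>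

lemma height_le_diff:
  assumes "prime_chain R k C" "C 0 = p" "krull_dim R \<le> enat d" "d \<le> k + h"
  shows "height R p \<le> enat h"
  unfolding height_def
proof (rule Sup_least)
  fix e assume "e \<in> {enat n |n. \<exists>C. prime_chain R n C \<and> C n = p}"
  then obtain n B where n: "e = enat n" "prime_chain R n B" "B n = p" by blast
  have "prime_chain R (n + k) (\<lambda>i. if i \<le> n then B i else C (i - n))"
    using prime_chain_append[OF n(2) assms(1)] n(3) assms(2) by simp
  then have "enat (n + k) \<le> krull_dim R"
    unfolding krull_dim_def by (intro Sup_upper) blast
  then have "enat (n + k) \<le> enat d" using assms(3) by (rule order_trans)
  then show "e \<le> enat h" using assms(4) n(1) by simp
qed

section \<open>Serre's criterion\<close>

context noetherian_local_ring begin

lemma mem_m_if_notin_adjoin: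
  assumes "ideal J R" "x \<in> carrier R" "a \<in> carrier R" "a \<notin> adjoin R J x"
  shows "x \<in> m"
proof (rule ccontr)
  assume "x \<notin> m"
  then obtain y where y: "y \<in> carrier R" "y \<otimes> x = \<one>" using unit_if_notin_m assms(2) by blast
  have "(a \<otimes> y) \<otimes> x = a" using y assms(2,3) by (simp add: m_assoc)
  moreover have "(a \<otimes> y) \<otimes> x \<in> adjoin R J x"
    using ideal_smult[OF adjoin_ideal[OF assms(1,2)] adjoin_self[OF assms(1,2)]] y assms(3) by blast
  ultimately show False using assms(4) by simp
qed

lemma mem_principal_iff:
  assumes "x \<in> carrier R" "a \<in> carrier R"
  shows "a \<in> adjoin R {\<zero>} x \<longleftrightarrow> (\<exists>c\<in>carrier R. a = x \<otimes> c)"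
proof
  assume "a \<in> adjoin R {\<zero>} x"
  then show "\<exists>c\<in>carrier R. a = x \<otimes> c"
    using assms by (elim mem_adjoinE[OF _ zeroideal assms(1)]) auto
next
  assume "\<exists>c\<in>carrier R. a = x \<otimes> c"
  then show "a \<in> adjoin R {\<zero>} x" using mem_adjoinI[of a x] assms by auto
qed

text \<open>If \<open>a\<close> is not in \<open>(x)\<close>, some associated prime \<open>P\<close>
  of \<open>(x)\<close> contains the annihilator of \<open>a\<close> modulo \<open>(x)\<close>,
  whereas local membership puts an \<open>s\<close> outside \<open>P\<close> into it. The assumption
  \<open>loc\<close> may presuppose \<open>x \<in> m\<close>, as otherwise \<open>x\<close> is a
  unit.\<close>

lemma mem_principal_local:
  assumes "x \<in> carrier R" "a \<in> carrier R"
    and loc: "\<And>P. \<lbrakk>x \<in> m; assoc_prime R (adjoin R {\<zero>} x) P\<rbrakk> \<Longrightarrow>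
      \<exists>s\<in>carrier R - P. \<exists>c\<in>carrier R. s \<otimes> a = x \<otimes> c"
  shows "\<exists>c\<in>carrier R. a = x \<otimes> c"
proof (rule ccontr)
  assume "\<not> ?thesis"
  then have a: "a \<notin> adjoin R {\<zero>} x" using mem_principal_iff assms(1,2) by simp
  then have x: "x \<in> m" using mem_m_if_notin_adjoin[OF zeroideal assms(1,2)] by simp
  obtain P where P: "assoc_prime R (adjoin R {\<zero>} x) P" "colon R (adjoin R {\<zero>} x) a \<subseteq> P"
    using assoc_prime_above_colon[OF adjoin_ideal[OF zeroideal assms(1)] assms(2) a] by metis
  obtain s c where s: "s \<in> carrier R - P" "c \<in> carrier R" "s \<otimes> a = x \<otimes> c"
    using loc[OF x P(1)] by blast
  then have "s \<otimes> a \<in> adjoin R {\<zero>} x"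
    using mem_principal_iff[of x "s \<otimes> a"] assms(1,2) by auto
  then have "s \<in> P" using P(2) s by (auto simp: colon_def)
  then show False using s by simp
qed

text \<open>The core of Serre's criterion, with its conditions packed into normality at the
  associated primes of zero and of the ideals generated by one regular element.\<close>

lemma normal_domain_if_normal_at_assoc_primes:
  assumes normal0: "\<And>P. assoc_prime R {\<zero>} P \<Longrightarrow> normal_domain (localization_at R P)"
    and normal1: "\<And>x P. \<lbrakk>x \<in> m; regular_mod R {\<zero>} x; assoc_prime R (adjoin R {\<zero>} x) P\<rbrakk> \<Longrightarrow>
      normal_domain (localization_at R P)"
  shows "normal_domain R"
proof -
  have reduced: "a = \<zero>" if a: "a \<in> carrier R" "a \<otimes> a = \<zero>" for a
  proof (rule ccontr)
    assume "a \<noteq> \<zero>"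
    \<comment> \<open>A multiple \<open>r a\<close> has a prime annihilator \<open>P\<close>, and
      its square is zero. In the domain at \<open>P\<close> it vanishes, so some \<open>s\<close>
      outside \<open>P\<close> kills it, a contradiction.\<close>
    then obtain P r where P: "assoc_prime R {\<zero>} P" "r \<in> carrier R" "P = colon R {\<zero>} (r \<otimes> a)"
      using assoc_prime_above_colon[OF zeroideal a(1)] by (metis singletonD)
    have b: "r \<otimes> a \<in> carrier R" using P a by simp
    have "(r \<otimes> a) \<otimes> (r \<otimes> a) = (r \<otimes> r) \<otimes> (a \<otimes> a)" using P(2) a(1) by (simp add: m_ac)
    then have "(r \<otimes> a) \<otimes> (r \<otimes> a) = \<zero>" using a P(2) by simp
    then obtain s where "s \<in> carrier R - P" "s \<otimes> (r \<otimes> a) = \<zero>"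
      using localization_at_domainD[of P "r \<otimes> a" "r \<otimes> a"] P(1) b normal0[OF P(1)]
      by (auto simp: assoc_prime_def normal_domain_iff)
    then show False unfolding P(3) by (auto simp: colon_def)
  qed
  have integral: "a = \<zero> \<or> b = \<zero>" if a: "a \<in> carrier R" and b: "b \<in> carrier R" and "a \<otimes> b = \<zero>" for a b
  proof (rule ccontr)
    assume nz: "\<not> (a = \<zero> \<or> b = \<zero>)"
    \<comment> \<open>\<open>I\<close> is the annihilator of \<open>a\<close> and contains
      \<open>b\<close>; \<open>K\<close> is the annihilator of \<open>I\<close>. Products of an
      element of \<open>I\<close> and one of \<open>K\<close> vanish.\<close>
    define I where "I = colon R {\<zero>} a"
    define K where "K = {c \<in> carrier R. \<forall>i\<in>I. c \<otimes> i = \<zero>}"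
    have I: "ideal I R" unfolding I_def using colon_ideal[OF zeroideal a] .
    have IR: "i \<in> carrier R" if "i \<in> I" for i using ideal_carr[OF I that] .
    have K: "ideal K R"
      by (rule ideal_intro) (use IR in \<open>auto simp: K_def l_distr m_assoc\<close>)
    have KR: "k \<in> carrier R" if "k \<in> K" for k using ideal_carr[OF K that] .
    have "\<exists>x\<in>I <+> K. regular_mod R {\<zero>} x \<and> regular_mod R {\<zero>} x"
    proof (rule regular_element_in_ideal[OF zeroideal zeroideal add_ideals[OF I K]])
      fix P assume "assoc_prime R {\<zero>} P \<or> assoc_prime R {\<zero>} P"
      then obtain u where u: "u \<in> carrier R" "P = colon R {\<zero>} u" and P: "primeideal P R"
        by (auto simp: assoc_prime_def)
      \<comment> \<open>If \<open>P\<close> annihilates \<open>u\<close> and contains both ideals,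
        then \<open>u\<close> kills \<open>I\<close>, so \<open>u \<in> K\<close>. Then
        \<open>u\<close> kills itself and is zero by reducedness.\<close>
      show "\<not> I <+> K \<subseteq> P"
      proof
        assume sub: "I <+> K \<subseteq> P"
        have kill: "(i \<oplus> k) \<otimes> u = \<zero>" if "i \<in> I" "k \<in> K" for i k
        proof -
          have "i \<oplus> k \<in> P" using sub that unfolding set_add_def' by blast
          then show ?thesis using u(2) by (auto simp: colon_def)
        qed
        have "u \<otimes> i = \<zero>" if "i \<in> I" for i
          using kill[OF that ideal_zero[OF K]] IR[OF that] u(1) by (simp add: m_comm)
        then have "u \<in> K" using u(1) by (simp add: K_def)
        then have "u \<otimes> u = \<zero>" using kill[OF ideal_zero[OF I] \<open>u \<in> K\<close>] u(1) by simp
        then have "u = \<zero>" by (rule reduced[OF u(1)])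
        then have "P = carrier R" unfolding u(2) by (auto simp: colon_def)
        then show False using primeideal.I_notcarr[OF P] by simp
      qed
    qed
    then obtain i k where x: "i \<in> I" "k \<in> K" "regular_mod R {\<zero>} (i \<oplus> k)"
      unfolding set_add_def' by blast
    note c = IR[OF x(1)] KR[OF x(2)]
    have ik: "i \<otimes> k = \<zero>" using x c by (auto simp: K_def m_comm)
    have xR: "i \<oplus> k \<in> carrier R" using c by simp
    have xreg: "c = \<zero>" if "c \<in> carrier R" "(i \<oplus> k) \<otimes> c = \<zero>" for c
      using regular_modD[OF x(3) that(1)] that(2) by simp
    \<comment> \<open>Since \<open>i k = 0\<close>, in each localization that is a domain
      \<open>i\<close> or \<open>k\<close> vanishes, and \<open>i / (i + k)\<close> is there 0 or
      1.\<close>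
    have "\<exists>e\<in>carrier R. i = (i \<oplus> k) \<otimes> e"
    proof (rule mem_principal_local[OF xR c(1)])
      fix P assume P: "i \<oplus> k \<in> m" "assoc_prime R (adjoin R {\<zero>} (i \<oplus> k)) P"
      then obtain s where s: "s \<in> carrier R - P" "s \<otimes> i = \<zero> \<or> s \<otimes> k = \<zero>"
        using localization_at_domainD[of P i k] c ik normal1[OF P(1) x(3) P(2)]
        by (auto simp: assoc_prime_def normal_domain_iff)
      have sR: "s \<in> carrier R" using s(1) by simp
      have "(i \<oplus> k) \<otimes> s = s \<otimes> i \<oplus> s \<otimes> k"
        using c sR by (simp add: diff_simps)
      then have "s \<otimes> i = (i \<oplus> k) \<otimes> \<zero> \<or> s \<otimes> i = (i \<oplus> k) \<otimes> s"
        using s(2) c sR by auto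
      then show "\<exists>s\<in>carrier R - P. \<exists>c\<in>carrier R. s \<otimes> i = (i \<oplus> k) \<otimes> c" using s(1) by blast
    qed
    then obtain e where e: "e \<in> carrier R" "i = (i \<oplus> k) \<otimes> e" by blast
    have ee: "e \<otimes> e = e"
    proof -
      \<comment> \<open>Multiplying \<open>e - e e\<close> by the square of the regular element
        \<open>i + k\<close> gives \<open>i k\<close>, which is zero.\<close>
      have "(i \<oplus> k) \<otimes> ((i \<oplus> k) \<otimes> (e \<ominus> e \<otimes> e)) =
          (i \<oplus> k) \<otimes> ((i \<oplus> k) \<otimes> e) \<ominus> ((i \<oplus> k) \<otimes> e) \<otimes> ((i \<oplus> k) \<otimes> e)"
        using c e(1) by (simp add: diff_simps)
      also have "\<dots> = (i \<oplus> k) \<otimes> i \<ominus> i \<otimes> i" unfolding e(2)[symmetric] ..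
      also have "\<dots> = i \<otimes> k"
        using c by (simp add: diff_simps)
      finally have "(i \<oplus> k) \<otimes> ((i \<oplus> k) \<otimes> (e \<ominus> e \<otimes> e)) = \<zero>" using ik by simp
      then have "(i \<oplus> k) \<otimes> (e \<ominus> e \<otimes> e) = \<zero>" by (rule xreg[rotated]) (use xR e(1) in simp)
      then have "e \<ominus> e \<otimes> e = \<zero>" by (rule xreg[rotated]) (use e(1) in simp)
      then show ?thesis using e(1) by simp
    qed
    show False
    \<comment> \<open>In the local ring the idempotent \<open>e\<close> is 0 or 1, so
      \<open>i + k\<close> equals \<open>k\<close> or \<open>i\<close>. The first kills
      \<open>b\<close> and the second kills \<open>a\<close>, against regularity.\<close>
    proof (cases "e \<in> m")
      case True
      then have "e = \<zero>"
        using mem_if_one_minus_mult_mem[OF zeroideal True one_closed e(1)] e(1) ee by simp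
      then have "i = \<zero>" using e xR by simp
      have "b \<in> I" using a b \<open>a \<otimes> b = \<zero>\<close> by (simp add: I_def colon_def m_comm)
      then have "k \<otimes> b = \<zero>" using x(2) by (auto simp: K_def)
      then have "(i \<oplus> k) \<otimes> b = \<zero>" using \<open>i = \<zero>\<close> c by simp
      then show False using xreg b nz by blast
    next
      case False
      then obtain y where y: "y \<in> carrier R" "y \<otimes> e = \<one>" using unit_if_notin_m e(1) by blast
      have "e = (y \<otimes> e) \<otimes> e" using y e by simp
      also have "\<dots> = y \<otimes> (e \<otimes> e)" using y(1) e(1) by (simp add: m_assoc)
      also have "\<dots> = \<one>" using ee y by simp
      finally have "i = i \<oplus> k" using e xR by simp
      then have "(i \<oplus> k) \<otimes> a = \<zero>" using x(1) by (simp add: I_def colon_def)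
      then show False using xreg a nz by blast
    qed
  qed
  have "\<one> \<noteq> \<zero>" using one_notin_m ideal_zero[OF m_ideal] by metis
  then interpret D: domain R using integral by unfold_locales auto
  have "\<exists>c\<in>carrier R. a = b \<otimes> c"
    if a: "a \<in> carrier R" and b: "b \<in> carrier R" "b \<noteq> \<zero>" and int: "integral_quotient R a b" for a b
  proof (rule mem_principal_local[OF b(1) a])
    have reg: "regular_mod R {\<zero>} b" using b by (auto simp: regular_mod_def D.integral_iff)
    fix P assume P: "b \<in> m" "assoc_prime R (adjoin R {\<zero>} b) P"
    then show "\<exists>s\<in>carrier R - P. \<exists>c\<in>carrier R. s \<otimes> a = b \<otimes> c"
      using D.localization_at_normalD[OF _ normal1[OF P(1) reg P(2)] a b int]
      by (simp add: assoc_prime_def)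
  qed
  then show ?thesis unfolding normal_domain_iff using D.domain_axioms by auto
qed

text \<open>The Cohen--Macaulay hypothesis identifies the depth \<open>d\<close> with the dimension.
  An associated prime of an ideal of depth at least \<open>d - 1\<close> starts a chain of that
  length, which leaves at most 1 for its height.\<close>

lemma normal_domain_if_normal_at_height_le_1:
  assumes CM: "depth R m = krull_dim R"
    and normal: "\<And>P. \<lbrakk>primeideal P R; height R P \<le> 1\<rbrakk> \<Longrightarrow> normal_domain (localization_at R P)"
  shows "normal_domain R"
proof -
  obtain d where d: "depth R m = enat d" "depth_ge d {\<zero>}"
    using depth_attained by blast
  have dim: "krull_dim R = enat d" using d(1) CM by simp
  have normal_assoc: "normal_domain (localization_at R P)"
    if P: "assoc_prime R J P" "depth_ge k J" "d \<le> k + 1" for J P k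
  proof (rule normal)
    show "primeideal P R" using P(1) by (simp add: assoc_prime_def)
    obtain C where C: "prime_chain R k C" "C 0 = P" using assoc_prime_chain[OF P(2,1)] by blast
    show "height R P \<le> 1" using height_le_diff[OF C _ P(3)] dim by (simp add: one_enat_def)
  qed
  show ?thesis
  proof (rule normal_domain_if_normal_at_assoc_primes)
    show "normal_domain (localization_at R P)" if "assoc_prime R {\<zero>} P" for P
      using normal_assoc[OF that d(2)] by simp
  next
    fix x P assume x: "x \<in> m" "regular_mod R {\<zero>} x" and P: "assoc_prime R (adjoin R {\<zero>} x) P"
    \<comment> \<open>For \<open>d = 0\<close> there is no predecessor to pass to;
      \<open>k = 0\<close> then satisfies the bound.\<close>
    have "\<exists>k. depth_ge k (adjoin R {\<zero>} x) \<and> d \<le> k + 1"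
    proof (cases d)
      case 0
      have "depth_ge 0 {\<zero>}" using depth_ge_mono[OF d(2)] by blast
      then have "depth_ge 0 (adjoin R {\<zero>} x)"
        using adjoin_ideal[OF zeroideal m_carr[OF x(1)]] adjoin_le_m x(1) by simp
      then show ?thesis using 0 by (intro exI[of _ 0]) simp
    next
      case (Suc k)
      then show ?thesis using depth_ge_adjoin[OF _ x, of k] d(2) by auto
    qed
    then show "normal_domain (localization_at R P)" using normal_assoc[OF P] by blast
  qed
qed

end

theorem corollary2p3:
  fixes A :: "('a, 'b) ring_scheme"
  assumes "cohen_macaulay_local_ring A"
  shows "normal_domain A \<longleftrightarrow>
    (\<forall>p. primeideal p A \<longrightarrow> height A p \<le> 1 \<longrightarrow> normal_domain (localization_at A p))"
proof
  assume "normal_domain A"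
  then show "\<forall>p. primeideal p A \<longrightarrow> height A p \<le> 1 \<longrightarrow> normal_domain (localization_at A p)"
    using normal_domain.normal_localization_at by blast
next
  assume normal: "\<forall>p. primeideal p A \<longrightarrow> height A p \<le> 1 \<longrightarrow> normal_domain (localization_at A p)"
  interpret cohen_macaulay_local_ring A by fact
  obtain m where m: "maximalideal m A" using unique_maximal by blast
  have "noetherian_local_ring A m"
    using m by (intro noetherian_local_ring.intro noetherian_cring.intro
        noetherian_local_ring_axioms.intro is_cring local_ring_axioms noetherian_ring_axioms)
  then show "normal_domain A"
    using noetherian_local_ring.normal_domain_if_normal_at_height_le_1 depth_eq_dim[OF m] normal
    by blast
qed

end
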